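(* Let $\varphi$ be a sublinear metric-compatible function and $T\in\mathrm{Aut}(X,\mu)$ aperiodic. Then for every measurable $A\subseteq X$ and every integer $n\ge2$ there exists an $n$-cycle $P\in[T]_\varphi$ whose support $\{x:P(x)\ne x\}$ equals $A$ (up to null sets).
   Context: $(X,\mu)$ standard atomless probability space; $\mathrm{Aut}(X,\mu)$ measure-preserving transformations modulo null sets. For aperiodic $T$, $[T]$ is the set of $U\in\mathrm{Aut}(X,\mu)$ with $U(x)=T^{c_U(x)}(x)$ a.e. for a measurable $c_U:X\to\mathbb Z$. $\varphi:\mathbb R_+\to\mathbb R_+$ is metric-compatible if subadditive, non-decreasing, $\varphi(0)=0$, $\varphi(t)>0$ for $t>0$; sublinear if $\varphi(t)/t\to0$. $[T]_\varphi=\{U\in[T]:\int_X\varphi(|c_U|)d\mu<\infty\}$. An $n$-cycle ($n\ge2$) is a $P\in\mathrm{Aut}(X,\mu)$ all of whose orbits have cardinality $1$ or $n$ (almost surely). *)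

theory Defs
  imports "HOL-Probability.Probability"
begin

definition standard_atomless_prob :: "('a::polish_space) measure \<Rightarrow> bool" where
  "standard_atomless_prob M \<longleftrightarrow> prob_space M \<and> sets M = sets borel \<and>
     (\<forall>A\<in>sets M. measure M A > 0 \<longrightarrow>
        (\<exists>B\<in>sets M. B \<subseteq> A \<and> 0 < measure M B \<and> measure M B < measure M A))"

definition aut :: "'a measure \<Rightarrow> ('a \<Rightarrow> 'a) \<Rightarrow> bool" where
  "aut M T \<longleftrightarrow> bij_betw T (space M) (space M) \<and> T \<in> M \<rightarrow>\<^sub>M M \<and>
     the_inv_into (space M) T \<in> M \<rightarrow>\<^sub>M M \<and> distr M M T = M"

definition ipow :: "'a measure \<Rightarrow> ('a \<Rightarrow> 'a) \<Rightarrow> int \<Rightarrow> 'a \<Rightarrow> 'a" where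
  "ipow M T k = (if 0 \<le> k then T ^^ nat k else (the_inv_into (space M) T) ^^ nat (- k))"

definition aperiodic :: "'a measure \<Rightarrow> ('a \<Rightarrow> 'a) \<Rightarrow> bool" where
  "aperiodic M T \<longleftrightarrow> (AE x in M. \<forall>n::nat. 0 < n \<longrightarrow> (T ^^ n) x \<noteq> x)"

definition full_group :: "'a measure \<Rightarrow> ('a \<Rightarrow> 'a) \<Rightarrow> ('a \<Rightarrow> 'a) set" where
  "full_group M T = {U. aut M U \<and> (\<exists>c::'a \<Rightarrow> int. c \<in> M \<rightarrow>\<^sub>M count_space UNIV \<and>
      (AE x in M. U x = ipow M T (c x) x))}"

definition phi_full_group ::
    "(real \<Rightarrow> real) \<Rightarrow> 'a measure \<Rightarrow> ('a \<Rightarrow> 'a) \<Rightarrow> ('a \<Rightarrow> 'a) set" where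
  "phi_full_group \<phi> M T = {U. aut M U \<and> (\<exists>c::'a \<Rightarrow> int. c \<in> M \<rightarrow>\<^sub>M count_space UNIV \<and>
      (AE x in M. U x = ipow M T (c x) x) \<and>
      (\<integral>\<^sup>+ x. ennreal (\<phi> (real_of_int \<bar>c x\<bar>)) \<partial>M) < \<infinity>)}"

definition metric_compatible :: "(real \<Rightarrow> real) \<Rightarrow> bool" where
  "metric_compatible \<phi> \<longleftrightarrow>
     (\<forall>t\<ge>0. \<phi> t \<ge> 0) \<and>
     (\<forall>s\<ge>0. \<forall>t\<ge>0. \<phi> (s + t) \<le> \<phi> s + \<phi> t) \<and>
     mono_on {0..} \<phi> \<and> \<phi> 0 = 0 \<and> (\<forall>t>0. \<phi> t > 0)"

definition sublinear :: "(real \<Rightarrow> real) \<Rightarrow> bool" where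
  "sublinear \<phi> \<longleftrightarrow> ((\<lambda>t. \<phi> t / t) \<longlongrightarrow> 0) at_top"

definition is_n_cycle :: "'a measure \<Rightarrow> nat \<Rightarrow> ('a \<Rightarrow> 'a) \<Rightarrow> bool" where
  "is_n_cycle M n P \<longleftrightarrow> aut M P \<and>
     (AE x in M. finite {ipow M P k x | k. True} \<and>
        card {ipow M P k x | k. True} \<in> {1, n})"

end

theory Submission
  imports Defs
begin

text \<open>
  Fix a marker set C, that is, a set of small measure which meets almost every T-orbit with
  bounded gaps. C cuts each orbit into intervals; inside an interval, the points of a set B are
  grouped from the right into blocks of n consecutive points, leaving at most n - 1 points per
  interval, so that the remainder has measure at most n times that of C. Permuting each block
  cyclically costs at most n times the integral of \<phi>(length of the block) over the set of block
  bases. The blocks are disjoint orbit segments, so the integral of the length is at most 1 (Kac),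
  and as \<phi>(s) \<le> b(\<delta>) + \<delta> s by sublinearity, the cost is at most n (b(\<delta>) \<mu>(B) + \<delta>) however small
  the remainder is required to be. Starting from A and repeating this with the remainder in place
  of B, the m-th remainder can therefore be chosen so small that the cost of the following stage
  is at most of order 1/2^m. The costs are summable and the remainders shrink to a null set.
\<close>

section \<open>Mass transport along orbits\<close>

text \<open>The powers of an invertible transformation are treated as an integer action, so that
  forward and backward times obey one additivity law.\<close>

locale pmp_int_action = prob_space M for M :: "'a measure" +
  fixes \<sigma> :: "int \<Rightarrow> 'a \<Rightarrow> 'a"
  assumes space_UNIV [simp]: "space M = UNIV"
    and act_0 [simp]: "\<sigma> 0 x = x"
    and act_add: "\<sigma> (a + b) x = \<sigma> a (\<sigma> b x)"
    and act_measurable [measurable]: "\<sigma> a \<in> M \<rightarrow>\<^sub>M M"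
    and act_distr: "distr M M (\<sigma> a) = M"
begin

lemma act_inverse [simp]: "\<sigma> (- a) (\<sigma> a x) = x" "\<sigma> a (\<sigma> (- a) x) = x"
  by (simp_all flip: act_add)

lemma act_eq_iff: "\<sigma> a x = y \<longleftrightarrow> x = \<sigma> (- a) y"
  by auto

lemma act_diff: "\<sigma> a x = \<sigma> b y \<Longrightarrow> \<sigma> (a - b) x = y"
  using act_add[of "- b" a x] by simp

lemma nn_integral_act:
  "g \<in> borel_measurable M \<Longrightarrow> (\<integral>\<^sup>+ x. g (\<sigma> a x) \<partial>M) = (\<integral>\<^sup>+ x. g x \<partial>M)"
  using nn_integral_distr[of "\<sigma> a" M M g] by (simp add: act_distr)

text \<open>Read \<open>w a x\<close> as the mass that \<open>x\<close> sends to
  \<open>\<sigma> a x\<close>: the two sides are the total mass sent and the total mass received.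
  Invariance shifts each summand, and Tonelli exchanges sum and integral.\<close>

lemma mass_transport:
  assumes [measurable]: "\<And>a. w a \<in> borel_measurable M"
  shows "(\<integral>\<^sup>+ x. (\<integral>\<^sup>+ a. w a x \<partial>count_space UNIV) \<partial>M)
       = (\<integral>\<^sup>+ y. (\<integral>\<^sup>+ a. w a (\<sigma> (- a) y) \<partial>count_space (UNIV :: int set)) \<partial>M)"
proof -
  have "(\<integral>\<^sup>+ x. (\<integral>\<^sup>+ a. w a x \<partial>count_space UNIV) \<partial>M) = (\<integral>\<^sup>+ a. (\<integral>\<^sup>+ x. w a x \<partial>M) \<partial>count_space UNIV)"
    by (rule nn_integral_count_space_nn_integral) auto
  also have "\<dots> = (\<integral>\<^sup>+ a. (\<integral>\<^sup>+ x. w a (\<sigma> (- a) x) \<partial>M) \<partial>count_space UNIV)"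
    by (subst nn_integral_act) auto
  also have "\<dots> = (\<integral>\<^sup>+ y. (\<integral>\<^sup>+ a. w a (\<sigma> (- a) y) \<partial>count_space UNIV) \<partial>M)"
    by (rule nn_integral_count_space_nn_integral[symmetric]) auto
  finally show ?thesis .
qed

text \<open>The exponent ranges over a countable set, so this form shows images to be countable
  unions of measurable sets, even without injectivity.\<close>

lemma act_image_eq:
  "(\<lambda>x. \<sigma> (\<kappa> x) x) ` D = {y. \<exists>a. \<sigma> (- a) y \<in> D \<and> \<kappa> (\<sigma> (- a) y) = a}"
proof (intro subset_antisym subsetI)
  fix y assume "y \<in> {y. \<exists>a. \<sigma> (- a) y \<in> D \<and> \<kappa> (\<sigma> (- a) y) = a}"
  then obtain a where "\<sigma> (- a) y \<in> D" "\<kappa> (\<sigma> (- a) y) = a" by auto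
  then show "y \<in> (\<lambda>x. \<sigma> (\<kappa> x) x) ` D"
    by (intro image_eqI[of _ _ "\<sigma> (- a) y"]) auto
next
  fix y assume "y \<in> (\<lambda>x. \<sigma> (\<kappa> x) x) ` D"
  then obtain x where "x \<in> D" "y = \<sigma> (\<kappa> x) x" by auto
  then show "y \<in> {y. \<exists>a. \<sigma> (- a) y \<in> D \<and> \<kappa> (\<sigma> (- a) y) = a}"
    by (auto intro!: exI[of _ "\<kappa> x"])
qed

lemma sets_act_image [measurable]:
  assumes [measurable]: "D \<in> sets M" "\<kappa> \<in> M \<rightarrow>\<^sub>M count_space UNIV"
  shows "(\<lambda>x. \<sigma> (\<kappa> x) x) ` D \<in> sets M"
proof -
  have "{y \<in> space M. \<exists>a. \<sigma> (- a) y \<in> D \<and> \<kappa> (\<sigma> (- a) y) = a} \<in> sets M"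
    by measurable
  then show ?thesis by (simp add: act_image_eq)
qed

lemma measurable_act_cocycle [measurable]:
  assumes [measurable]: "\<kappa> \<in> M \<rightarrow>\<^sub>M count_space UNIV"
  shows "(\<lambda>x. \<sigma> (\<kappa> x) x) \<in> M \<rightarrow>\<^sub>M M"
  by (rule measurable_compose_countable) auto

text \<open>In the transport each \<open>x\<close> in \<open>D\<close> sends
  \<open>g (\<sigma> (\<kappa> x) x)\<close> to its image. By injectivity every image point receives
  from exactly one source.\<close>

lemma nn_integral_act_image:
  assumes [measurable]: "D \<in> sets M" "\<kappa> \<in> M \<rightarrow>\<^sub>M count_space UNIV" "g \<in> borel_measurable M"
    and inj: "inj_on (\<lambda>x. \<sigma> (\<kappa> x) x) D"
  shows "(\<integral>\<^sup>+ x\<in>D. g (\<sigma> (\<kappa> x) x) \<partial>M) = (\<integral>\<^sup>+ y\<in>(\<lambda>x. \<sigma> (\<kappa> x) x) ` D. g y \<partial>M)"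
proof -
  define w where "w a x = g (\<sigma> a x) * indicator {x. x \<in> D \<and> \<kappa> x = a} x" for a x
  have [measurable]: "{x. x \<in> D \<and> \<kappa> x = a} \<in> sets M" for a
  proof -
    have "{x \<in> space M. x \<in> D \<and> \<kappa> x = a} \<in> sets M" by measurable
    then show ?thesis by simp
  qed
  have [measurable]: "w a \<in> borel_measurable M" for a
    unfolding w_def by measurable
  have 1: "(\<integral>\<^sup>+ a. w a x \<partial>count_space UNIV) = g (\<sigma> (\<kappa> x) x) * indicator D x" for x
  proof -
    have "(\<integral>\<^sup>+ a. w a x \<partial>count_space UNIV) = (\<integral>\<^sup>+ a. (g (\<sigma> (\<kappa> x) x) * indicator D x) * indicator {\<kappa> x} a \<partial>count_space UNIV)"
      by (intro nn_integral_cong) (auto simp: w_def indicator_def)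
    then show ?thesis by (simp add: nn_integral_cmult)
  qed
  have 2: "(\<integral>\<^sup>+ a. w a (\<sigma> (- a) y) \<partial>count_space UNIV) = g y * indicator ((\<lambda>x. \<sigma> (\<kappa> x) x) ` D) y" for y
  proof (cases "y \<in> (\<lambda>x. \<sigma> (\<kappa> x) x) ` D")
    case True
    then obtain x where x: "x \<in> D" "y = \<sigma> (\<kappa> x) x" by auto
    have "a = \<kappa> x" if "\<sigma> (- a) y \<in> D" "\<kappa> (\<sigma> (- a) y) = a" for a
    proof -
      have "\<sigma> (- a) y = x"
        using inj_onD[OF inj, of "\<sigma> (- a) y" x] that x by simp
      then show ?thesis using that by simp
    qed
    then have "(\<integral>\<^sup>+ a. w a (\<sigma> (- a) y) \<partial>count_space UNIV) = (\<integral>\<^sup>+ a. g y * indicator {\<kappa> x} a \<partial>count_space UNIV)"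
      using x by (intro nn_integral_cong) (auto simp: w_def indicator_def)
    then show ?thesis using True by (simp add: nn_integral_cmult)
  next
    case False
    then have "w a (\<sigma> (- a) y) = 0" for a
      by (auto simp: w_def act_image_eq)
    then show ?thesis using False by simp
  qed
  show ?thesis
    using mass_transport[of w] by (simp add: 1 2)
qed

lemma emeasure_act_image:
  assumes [measurable]: "D \<in> sets M" "\<kappa> \<in> M \<rightarrow>\<^sub>M count_space UNIV"
    and "inj_on (\<lambda>x. \<sigma> (\<kappa> x) x) D"
  shows "emeasure M ((\<lambda>x. \<sigma> (\<kappa> x) x) ` D) = emeasure M D"
  using nn_integral_act_image[of D \<kappa> "\<lambda>_. 1"] assms by simp

text \<open>By surjectivity \<open>E\<close> is the image of its preimage, so the two have equal
  measure by \<open>emeasure_act_image\<close>.\<close>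

lemma distr_act_cocycle:
  assumes [measurable]: "c \<in> M \<rightarrow>\<^sub>M count_space UNIV"
    and bij: "bij (\<lambda>x. \<sigma> (c x) x)"
  shows "distr M M (\<lambda>x. \<sigma> (c x) x) = M"
proof (rule measure_eqI)
  fix E assume "E \<in> sets (distr M M (\<lambda>x. \<sigma> (c x) x))"
  then have E [measurable]: "E \<in> sets M" by simp
  define P where "P x = \<sigma> (c x) x" for x
  have P [measurable]: "P \<in> M \<rightarrow>\<^sub>M M" unfolding P_def by measurable
  have bij': "bij P" using bij by (simp add: P_def[abs_def])
  have "P -` E \<in> sets M" using measurable_sets[OF P E] by simp
  moreover have "inj_on (\<lambda>x. \<sigma> (c x) x) (P -` E)"
    using bij by (auto simp: bij_def intro: inj_on_subset)
  ultimately have "emeasure M ((\<lambda>x. \<sigma> (c x) x) ` (P -` E)) = emeasure M (P -` E)"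
    by (intro emeasure_act_image) auto
  moreover have "(\<lambda>x. \<sigma> (c x) x) ` (P -` E) = E"
    using bij' unfolding P_def[symmetric] by (simp add: bij_is_surj)
  ultimately show "emeasure (distr M M (\<lambda>x. \<sigma> (c x) x)) E = emeasure M E"
    unfolding P_def[symmetric] by (simp add: emeasure_distr)
qed auto

text \<open>The points \<open>\<sigma> (int d) x\<close> with \<open>x\<close> in \<open>D\<close>
  and \<open>d \<le> K x\<close> are pairwise distinct, since a coincidence would produce a return
  to \<open>D\<close> that \<open>ret\<close> forbids. The integral adds up the measures of the
  resulting disjoint translates.\<close>

lemma kac_inequality:
  fixes K :: "'a \<Rightarrow> nat"
  assumes [measurable]: "D \<in> sets M" "K \<in> M \<rightarrow>\<^sub>M count_space UNIV"
    and ret: "\<And>x d. x \<in> D \<Longrightarrow> 1 \<le> d \<Longrightarrow> d \<le> K x \<Longrightarrow> \<sigma> (int d) x \<notin> D"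
  shows "(\<integral>\<^sup>+ x\<in>D. of_nat (K x + 1) \<partial>M) \<le> 1"
proof -
  \<comment> \<open>\<open>L\<close> vanishes off \<open>D\<close>, so its level sets
    \<open>S t\<close> are \<open>{x \<in> D. t \<le> K x}\<close> and the integral is the sum of
    their measures.\<close>
  define L where "L x = (if x \<in> D then K x + 1 else 0)" for x
  have [measurable]: "L \<in> M \<rightarrow>\<^sub>M count_space UNIV" unfolding L_def by measurable
  define S where "S t = {x \<in> space M. t < L x}" for t
  have [measurable]: "S t \<in> sets M" for t unfolding S_def by measurable
  have inj: "inj_on (\<lambda>x. \<sigma> (int t) x) (S t)" for t
    by (auto simp: inj_on_def act_eq_iff)
  have S: "x \<in> S t \<longleftrightarrow> x \<in> D \<and> t \<le> K x" for x t by (auto simp: S_def L_def)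
  have disj': "\<sigma> (int s) ` S s \<inter> \<sigma> (int t) ` S t = {}" if "s < t" for s t
  proof (rule ccontr)
    assume "\<sigma> (int s) ` S s \<inter> \<sigma> (int t) ` S t \<noteq> {}"
    then obtain x y where xy: "x \<in> S s" "y \<in> S t" "\<sigma> (int s) x = \<sigma> (int t) y"
      by auto
    have "\<sigma> (int (t - s)) y = x"
      using act_diff[OF xy(3)[symmetric]] \<open>s < t\<close> by (simp add: of_nat_diff)
    moreover have "x \<in> D" "y \<in> D" "t - s \<le> K y" using xy by (auto simp: S)
    ultimately show False
      using ret[of y "t - s"] \<open>s < t\<close> by (simp add: Suc_le_eq)
  qed
  have disj: "disjoint_family (\<lambda>t. \<sigma> (int t) ` S t)"
    unfolding disjoint_family_on_def using disj' by (metis inf_commute nat_neq_iff)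
  have m: "\<sigma> (int t) ` S t \<in> sets M" for t
    using sets_act_image[of "S t" "\<lambda>_. int t"] by simp
  have "(\<integral>\<^sup>+ x\<in>D. of_nat (K x + 1) \<partial>M) = (\<integral>\<^sup>+ x. of_nat (L x) \<partial>M)"
    by (intro nn_integral_cong) (auto simp: L_def indicator_def)
  also have "\<dots> = (\<Sum>t. emeasure M (S t))"
    unfolding S_def by (rule nn_integral_nat_function) measurable
  also have "\<dots> = (\<Sum>t. emeasure M (\<sigma> (int t) ` S t))"
    using emeasure_act_image[of "S t" "\<lambda>_. int t" for t] inj by simp
  also have "\<dots> = emeasure M (\<Union>t. \<sigma> (int t) ` S t)"
    using m by (intro suminf_emeasure disj) auto
  also have "\<dots> \<le> 1" by (rule emeasure_le_1)
  finally show ?thesis .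
qed

end

section \<open>Markers and block decompositions\<close>

text \<open>A measurable substitute for choosing a maximal \<open>N\<close>-separated subset of each
  orbit: all points of \<open>E m\<close> that are far from earlier choices are accepted at once,
  which is harmless if \<open>E m\<close> itself is separated.\<close>

primrec greedy_marker :: "(int \<Rightarrow> 'a \<Rightarrow> 'a) \<Rightarrow> int \<Rightarrow> (nat \<Rightarrow> 'a set) \<Rightarrow> nat \<Rightarrow> 'a set" where
  "greedy_marker \<sigma> N E 0 = {}"
| "greedy_marker \<sigma> N E (Suc m) = greedy_marker \<sigma> N E m \<union>
     {x \<in> E m. \<forall>j\<in>{-N..N}. \<sigma> j x \<notin> greedy_marker \<sigma> N E m}"

context pmp_int_action
begin

definition free_part :: "'a set" where
  "free_part = {x. \<forall>j. j \<noteq> 0 \<longrightarrow> \<sigma> j x \<noteq> x}"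

lemma act_free_part [simp]: "\<sigma> a x \<in> free_part \<longleftrightarrow> x \<in> free_part"
proof -
  have "\<sigma> j (\<sigma> a x) = \<sigma> a x \<longleftrightarrow> \<sigma> j x = x" for j
    by (metis act_add act_inverse(1) add.commute)
  then show ?thesis by (simp add: free_part_def)
qed

text \<open>The union of the greedy stages works. Points accepted at the same stage are apart by
  \<open>sep\<close>, those of different stages by the test at the later one; a rejected point has a
  chosen point near it.\<close>

lemma exists_marker_of_cover:
  assumes [measurable]: "\<And>m::nat. E m \<in> sets M" and "0 \<le> N"
    and sep: "\<And>m x j. x \<in> E m \<Longrightarrow> 1 \<le> j \<Longrightarrow> j \<le> N \<Longrightarrow> \<sigma> j x \<notin> E m"
    and cover: "Y \<subseteq> (\<Union>m. E m)"
  shows "\<exists>C\<in>sets M. (\<forall>x\<in>C. \<forall>j. 1 \<le> j \<longrightarrow> j \<le> N \<longrightarrow> \<sigma> j x \<notin> C) \<and>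
           (\<forall>x\<in>Y. \<exists>j\<in>{-N..N}. \<sigma> j x \<in> C)"
proof -
  define G where "G = greedy_marker \<sigma> N E"
  have G_0: "G 0 = {}"
    and G_Suc: "G (Suc m) = G m \<union> {x \<in> E m. \<forall>j\<in>{-N..N}. \<sigma> j x \<notin> G m}" for m
    by (simp_all add: G_def)
  have G_sets [measurable]: "G m \<in> sets M" for m
  proof (induction m)
    case (Suc m)
    note [measurable] = Suc
    have "{x \<in> space M. x \<in> E m \<and> (\<forall>j\<in>{-N..N}. \<sigma> j x \<notin> G m)} \<in> sets M" by measurable
    then show ?case using Suc unfolding G_Suc by (intro sets.Un) auto
  qed (simp add: G_0)
  have G_sep: "\<sigma> j x \<notin> G m" if "x \<in> G m" "1 \<le> j" "j \<le> N" for m x j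
    using that(1)
  proof (induction m)
    case (Suc m)
    show ?case
    proof
      assume *: "\<sigma> j x \<in> G (Suc m)"
      \<comment> \<open>Either \<open>x\<close> or \<open>\<sigma> j x\<close> may be the newly
        accepted point, so the test is applied with \<open>j\<close> and with
        \<open>- j\<close>.\<close>
      have "j \<in> {-N..N}" "- j \<in> {-N..N}" using that by auto
      then have "x \<notin> G m" if "\<forall>i\<in>{-N..N}. \<sigma> i (\<sigma> j x) \<notin> G m"
        using that by (metis act_inverse(1))
      then show False
        using Suc * sep[of x m j] that \<open>j \<in> {-N..N}\<close> unfolding G_Suc by blast
    qed
  qed (simp add: G_0)
  have "mono G" by (rule incseq_SucI) (auto simp: G_Suc)
  have "\<sigma> j x \<notin> (\<Union>m. G m)" if x: "x \<in> (\<Union>m. G m)" and j: "1 \<le> j" "j \<le> N" for x j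
  proof
    assume "\<sigma> j x \<in> (\<Union>m. G m)"
    then obtain m m' where "x \<in> G m" "\<sigma> j x \<in> G m'" using x by auto
    then have "x \<in> G (max m m')" "\<sigma> j x \<in> G (max m m')"
      using monoD[OF \<open>mono G\<close>, of m "max m m'"] monoD[OF \<open>mono G\<close>, of m' "max m m'"] by auto
    then show False using G_sep j by blast
  qed
  moreover have "\<exists>j\<in>{-N..N}. \<sigma> j x \<in> (\<Union>m. G m)" if "x \<in> Y" for x
  proof -
    obtain m where m: "x \<in> E m" using cover \<open>x \<in> Y\<close> by auto
    show ?thesis
    proof (cases "\<forall>j\<in>{-N..N}. \<sigma> j x \<notin> G m")
      case True
      then have "\<sigma> 0 x \<in> G (Suc m)" using m by (simp add: G_Suc)
      then show ?thesis using \<open>0 \<le> N\<close> by (intro bexI[of _ 0]) auto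
    qed auto
  qed
  ultimately show ?thesis
    by (intro bexI[of _ "\<Union>m. G m"]) auto
qed

section \<open>Counting the visits of an orbit to a set\<close>

definition visits :: "'a set \<Rightarrow> 'a \<Rightarrow> nat \<Rightarrow> nat" where
  "visits B x t = card {i. i < t \<and> \<sigma> (int i) x \<in> B}"

lemma visits_0 [simp]: "visits B x 0 = 0"
  by (simp add: visits_def)

lemma visits_Suc: "visits B x (Suc t) = visits B x t + (if \<sigma> (int t) x \<in> B then 1 else 0)"
proof -
  have "{i. i < Suc t \<and> \<sigma> (int i) x \<in> B} =
      {i. i < t \<and> \<sigma> (int i) x \<in> B} \<union> (if \<sigma> (int t) x \<in> B then {t} else {})"
    by (auto simp: less_Suc_eq)
  then show ?thesis by (simp add: visits_def)
qed

lemma visits_add: "visits B x (t + u) = visits B x t + visits B (\<sigma> (int t) x) u"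
  by (induction u) (simp_all add: visits_Suc add.commute[of "int t"] flip: act_add)

lemma visits_mono: "t \<le> u \<Longrightarrow> visits B x t \<le> visits B x u"
  using visits_add[of B x t "u - t"] by simp

lemma visits_less: "\<sigma> (int t) x \<in> B \<Longrightarrow> t < u \<Longrightarrow> visits B x t < visits B x u"
  using visits_mono[of "Suc t" u B x] by (simp add: visits_Suc)

lemma visits_eq_imp_eq:
  assumes "visits B x t = visits B x u" "\<sigma> (int t) x \<in> B" "\<sigma> (int u) x \<in> B"
  shows "t = u"
  using assms visits_less[of t x B u] visits_less[of u x B t] by (cases t u rule: linorder_cases) auto

text \<open>\<open>visits\<close> does not count time \<open>t\<close> itself, so a visit at time
  \<open>t\<close> has index \<open>visits B x t\<close> and the numbering starts at 0. The count
  grows by unit steps and therefore passes through every index.\<close>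

lemma exists_visit:
  "i < visits B x h \<Longrightarrow> \<exists>t<h. \<sigma> (int t) x \<in> B \<and> visits B x t = i"
proof (induction h)
  case (Suc h)
  show ?case
  proof (cases "i < visits B x h")
    case True
    then show ?thesis using Suc by (meson less_SucI)
  next
    case False
    then show ?thesis using Suc.prems by (intro exI[of _ h]) (auto simp: visits_Suc split: if_splits)
  qed
qed simp

lemma measurable_visits [measurable]:
  assumes [measurable]: "B \<in> sets M"
  shows "(\<lambda>x. visits B x t) \<in> M \<rightarrow>\<^sub>M count_space UNIV"
  unfolding visits_def by measurable

text \<open>By \<open>visits_eq_imp_eq\<close> at most one time qualifies, so \<open>LEAST\<close>
  selects nothing but gives measurability. If the orbit makes too few visits, the value is
  unspecified.\<close>

definition visit_time :: "'a set \<Rightarrow> nat \<Rightarrow> 'a \<Rightarrow> nat" where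
  "visit_time B i x = (LEAST t. \<sigma> (int t) x \<in> B \<and> visits B x t = i)"

lemma visit_time_eq:
  assumes "\<sigma> (int t) x \<in> B" "visits B x t = i"
  shows "visit_time B i x = t"
  unfolding visit_time_def
  using assms visits_eq_imp_eq by (intro Least_equality) (auto intro!: eq_refl)

lemma visit_time:
  assumes "i < visits B x h"
  shows "visit_time B i x < h" "\<sigma> (int (visit_time B i x)) x \<in> B"
    "visits B x (visit_time B i x) = i"
  using exists_visit[OF assms] visit_time_eq by auto

lemma measurable_visit_time [measurable]:
  assumes [measurable]: "B \<in> sets M"
  shows "visit_time B i \<in> M \<rightarrow>\<^sub>M count_space UNIV"
  unfolding visit_time_def[abs_def] by measurable

section \<open>Blocks of consecutive visits and their bases\<close>

definition blocks :: "nat \<Rightarrow> 'a set \<Rightarrow> 'a set \<Rightarrow> 'a set" where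
  "blocks n B D = (\<Union>i<n. (\<lambda>x. \<sigma> (int (visit_time B i x)) x) ` D)"

text \<open>\<open>visit_time\<close> is meaningful only where the visits exist, hence the explicit
  containment in \<open>B\<close> and strict increase. The last clause keeps the orbit segments
  spanned by the blocks disjoint; it is the hypothesis of \<open>kac_inequality\<close> for
  \<open>K = visit_time B (n - 1)\<close>.\<close>

definition block_base :: "nat \<Rightarrow> 'a set \<Rightarrow> 'a set \<Rightarrow> bool" where
  "block_base n B D \<longleftrightarrow> D \<in> sets M \<and> D \<subseteq> B \<and> blocks n B D \<subseteq> B \<and>
     (\<forall>x\<in>D. \<forall>i j. i < j \<longrightarrow> j < n \<longrightarrow> visit_time B i x < visit_time B j x) \<and>
     (\<forall>x\<in>D. \<forall>d. 1 \<le> d \<longrightarrow> d \<le> visit_time B (n - 1) x \<longrightarrow> \<sigma> (int d) x \<notin> D)"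

text \<open>Within an interval between markers, \<open>s x\<close> counts the points of
  \<open>B\<close> from \<open>x\<close> to the right end. It drops by one at each of them, so the
  multiples of \<open>n\<close> mark the first points of the blocks counted from the right.\<close>

lemma exists_block_base:
  assumes [measurable]: "B \<in> sets M" "C \<in> sets M" and n: "0 < n"
    and B: "B \<subseteq> free_part"
    and fwd: "\<And>x. x \<in> free_part \<Longrightarrow> \<exists>j\<ge>1. \<sigma> (int j) x \<in> C"
    and bwd: "\<And>x. x \<in> free_part \<Longrightarrow> \<exists>j. \<sigma> (- int j) x \<in> C"
  shows "\<exists>D. block_base n B D \<and> emeasure M (B - blocks n B D) \<le> of_nat n * emeasure M C"
proof -
  \<comment> \<open>The bound \<open>1 \<le> j\<close> makes a marker the left end of its own
    interval; accordingly the backward time defined later may be 0.\<close>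
  define h where "h x = (LEAST j. 1 \<le> j \<and> \<sigma> (int j) x \<in> C)" for x
  define s where "s x = visits B x (h x)" for x
  define D where "D = {x \<in> B. n dvd s x}"
  have [measurable]: "h \<in> M \<rightarrow>\<^sub>M count_space UNIV" unfolding h_def[abs_def] by measurable
  have [measurable]: "s \<in> M \<rightarrow>\<^sub>M count_space UNIV" unfolding s_def[abs_def]
    by (rule measurable_compose_countable[where g=h and f="\<lambda>t x. visits B x t"]) auto
  have "{x \<in> space M. x \<in> B \<and> n dvd s x} \<in> sets M" by measurable
  then have D_sets [measurable]: "D \<in> sets M" by (simp add: D_def)
  have h: "1 \<le> h x" "\<sigma> (int (h x)) x \<in> C" if "x \<in> free_part" for x
    using LeastI_ex[OF fwd[OF that, unfolded Bex_def]] unfolding h_def by auto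
  have h_le: "h x \<le> j" if "1 \<le> j" "\<sigma> (int j) x \<in> C" for x j
    unfolding h_def using that by (intro Least_le) auto
  have h_shift: "h (\<sigma> (int t) x) = h x - t" if x: "x \<in> free_part" and t: "t < h x" for x t
  proof (rule antisym)
    have "\<sigma> (int (h x - t)) (\<sigma> (int t) x) = \<sigma> (int (h x)) x"
      using t by (simp add: of_nat_diff flip: act_add)
    then show "h (\<sigma> (int t) x) \<le> h x - t"
      using t h[OF x] by (intro h_le) auto
    have "\<sigma> (int (h (\<sigma> (int t) x) + t)) x \<in> C"
      using h(2)[of "\<sigma> (int t) x"] x by (simp add: act_add)
    moreover have "1 \<le> h (\<sigma> (int t) x) + t"
      using h(1)[of "\<sigma> (int t) x"] x by simp
    ultimately show "h x - t \<le> h (\<sigma> (int t) x)"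
      using h_le[of "h (\<sigma> (int t) x) + t" x] by simp
  qed
  have s_shift: "s x = visits B x t + s (\<sigma> (int t) x)" if "x \<in> free_part" "t < h x" for x t
    using visits_add[of B x t "h x - t"] that by (simp add: s_def h_shift)
  have s_pos: "1 \<le> s x" if "x \<in> B" for x
  proof -
    have "x \<in> free_part" using B that by auto
    then show ?thesis using visits_less[of 0 x B "h x"] that h[of x] by (simp add: s_def)
  qed
  have vt: "visit_time B i x < h x \<and> \<sigma> (int (visit_time B i x)) x \<in> B \<and>
      visits B x (visit_time B i x) = i" if "x \<in> D" "i < n" for x i
  proof -
    \<comment> \<open>Divisibility gives this because \<open>s x\<close> is positive; it places all
      \<open>n\<close> visits of the block before the next marker.\<close>
    have "n \<le> s x" using that s_pos[of x] by (auto simp: D_def intro: dvd_imp_le)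
    then have "i < visits B x (h x)" using that by (simp add: s_def)
    from visit_time[OF this] show ?thesis by simp
  qed
  have vt_mono: "visit_time B i x < visit_time B j x" if "x \<in> D" "i < j" "j < n" for x i j
    using vt[of x i] vt[of x j] that visits_mono[of "visit_time B j x" "visit_time B i x" B x]
    by (cases "visit_time B i x < visit_time B j x") auto
  \<comment> \<open>From \<open>x\<close> to \<open>\<sigma> (int d) x\<close> the value of
    \<open>s\<close> drops by the visits in between, at least 1 (at \<open>x\<close> itself) and at
    most \<open>n - 1\<close>, so \<open>n\<close> cannot divide it at both ends.\<close>
  have ret: "\<sigma> (int d) x \<notin> D" if x: "x \<in> D" and d: "1 \<le> d" "d \<le> visit_time B (n - 1) x" for x d
  proof
    assume "\<sigma> (int d) x \<in> D"
    have xB: "x \<in> B" "x \<in> free_part" using x B by (auto simp: D_def)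
    have v: "visit_time B (n - 1) x < h x" "visits B x (visit_time B (n - 1) x) = n - 1"
      using vt[of x "n - 1"] x n by auto
    have "s x = visits B x d + s (\<sigma> (int d) x)"
      using xB d v by (intro s_shift) auto
    then have "n dvd visits B x d"
      using \<open>\<sigma> (int d) x \<in> D\<close> x by (simp add: D_def dvd_add_left_iff)
    moreover have "0 < visits B x d" using visits_less[of 0 x B d] xB d by simp
    moreover have "visits B x d \<le> n - 1" using visits_mono[OF d(2), of B x] v by simp
    ultimately show False using n by (auto dest!: dvd_imp_le)
  qed
  \<comment> \<open>A point outside all blocks is among the first n points of B in its interval, so it is
    determined by the left endpoint p and the number V of points of B between p and the point.\<close>
  define j where "j x = (LEAST j. \<sigma> (- int j) x \<in> C)" for x
  define p where "p x = \<sigma> (- int (j x)) x" for x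
  define V where "V x = visits B (p x) (j x)" for x
  have [measurable]: "j \<in> M \<rightarrow>\<^sub>M count_space UNIV" unfolding j_def[abs_def] by measurable
  have [measurable]: "p \<in> M \<rightarrow>\<^sub>M M" unfolding p_def[abs_def] by measurable
  have [measurable]: "V \<in> M \<rightarrow>\<^sub>M count_space UNIV" unfolding V_def[abs_def]
    by (rule measurable_compose_countable[where g=j and f="\<lambda>t x. visits B (p x) t"]) auto
  have p_C: "p x \<in> C" if "x \<in> B" for x
    using LeastI_ex[OF bwd[of x]] that B unfolding p_def j_def by auto
  have act_p [simp]: "\<sigma> (int (j x)) (p x) = x" for x by (simp add: p_def)
  \<comment> \<open>Otherwise the marker after \<open>p x\<close> would lie at or before
    \<open>x\<close>, closer to it than \<open>p x\<close>.\<close>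
  have j_less: "j x < h (p x)" if "x \<in> B" for x
  proof (rule ccontr)
    assume "\<not> j x < h (p x)"
    then have le: "h (p x) \<le> j x" by simp
    have "p x \<in> free_part" using that B by (auto simp: p_def)
    note hp = h[OF this]
    have "\<sigma> (int (h (p x))) (p x) = \<sigma> (- int (j x - h (p x))) x"
      using le by (simp add: p_def of_nat_diff flip: act_add)
    then have "j x \<le> j x - h (p x)"
      using hp unfolding j_def[of x] by (intro Least_le) (simp flip: j_def)
    then show False using le hp by simp
  qed
  define R where "R i = {x \<in> B. V x = i}" for i
  have [measurable]: "R i \<in> sets M" for i
  proof -
    have "{x \<in> space M. x \<in> B \<and> V x = i} \<in> sets M" by measurable
    then show ?thesis by (simp add: R_def)
  qed
  have R_le: "emeasure M (R i) \<le> emeasure M C" for i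
  proof -
    have "inj_on (\<lambda>x. \<sigma> (- int (j x)) x) (R i)"
    proof (rule inj_onI)
      fix x y assume xy: "x \<in> R i" "y \<in> R i" "\<sigma> (- int (j x)) x = \<sigma> (- int (j y)) y"
      then have p: "p x = p y" by (simp add: p_def)
      have "visits B (p x) (j x) = visits B (p x) (j y)"
        using xy(1,2) p by (simp add: R_def V_def)
      moreover have "\<sigma> (int (j x)) (p x) \<in> B" "\<sigma> (int (j y)) (p x) \<in> B"
        using xy(1,2) act_p[of x] act_p[of y] unfolding R_def p by auto
      ultimately have "j x = j y" by (rule visits_eq_imp_eq)
      then show "x = y" using act_p p by metis
    qed
    then have "emeasure M (R i) = emeasure M ((\<lambda>x. \<sigma> (- int (j x)) x) ` R i)"
      by (intro emeasure_act_image[symmetric]) auto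
    also have "\<dots> \<le> emeasure M C"
      using p_C by (intro emeasure_mono) (auto simp: R_def p_def)
    finally show ?thesis .
  qed
  have left: "B - blocks n B D \<subseteq> (\<Union>i<n. R i)"
  proof
    fix x assume x: "x \<in> B - blocks n B D"
    have "V x < n"
    proof (rule ccontr)
      assume "\<not> V x < n"
      define c where "c = p x"
      \<comment> \<open>The residue of \<open>- s x\<close> modulo \<open>n\<close>; the outer
        \<open>mod\<close> turns the value \<open>n\<close> into 0. Stepping back \<open>i\<close>
        points of \<open>B\<close> from \<open>x\<close> gives a point \<open>z\<close> with
        \<open>n dvd s z\<close>, and \<open>i < n \<le> V x\<close> keeps \<open>z\<close> in the
        interval, so \<open>x\<close> lies in the block of \<open>z\<close>.\<close>
      define i where "i = (n - s x mod n) mod n"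
      have "n dvd s x + i"
        unfolding i_def dvd_eq_mod_eq_0
        by (metis add.commute le_add_diff_inverse2 less_imp_le_nat mod_add_left_eq mod_add_right_eq mod_less_divisor mod_self n)
      have "i < n" using n by (simp add: i_def)
      have xB: "x \<in> B" using x by simp
      have cF: "c \<in> free_part" using xB B by (auto simp: c_def p_def)
      have xc: "\<sigma> (int (j x)) c = x" by (simp add: c_def)
      have Vx: "visits B c (j x) = V x" by (simp add: c_def V_def)
      have sc: "s c = V x + s x"
        using s_shift[OF cF, of "j x"] j_less[OF xB] xc Vx by (simp add: c_def)
      define t where "t = visit_time B (V x - i) c"
      define z where "z = \<sigma> (int t) c"
      have "V x - i < visits B c (h c)" using sc s_pos[OF xB] by (simp add: s_def)
      from visit_time[OF this] have t: "t < h c" "z \<in> B" "visits B c t = V x - i"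
        by (auto simp: t_def z_def)
      have tj: "t \<le> j x"
        using visits_less[of "j x" c B t] xc xB Vx t(3) by (cases "t \<le> j x") auto
      have "s z = s x + i"
        using s_shift[OF cF t(1)] t(3) sc \<open>i < n\<close> \<open>\<not> V x < n\<close> by (simp add: z_def)
      then have "z \<in> D" using t(2) \<open>n dvd s x + i\<close> by (simp add: D_def)
      have xz: "\<sigma> (int (j x - t)) z = x"
        using tj xc by (simp add: z_def of_nat_diff flip: act_add)
      have "visits B z (j x - t) = i"
        using visits_add[of B c t "j x - t"] tj Vx t(3) \<open>i < n\<close> \<open>\<not> V x < n\<close> by (simp add: z_def)
      then have "visit_time B i z = j x - t"
        using xz xB by (intro visit_time_eq) auto
      then have "x \<in> (\<lambda>x. \<sigma> (int (visit_time B i x)) x) ` D"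
        using xz \<open>z \<in> D\<close> by (intro image_eqI[of _ _ z]) auto
      then show False using x \<open>i < n\<close> by (auto simp: blocks_def)
    qed
    then show "x \<in> (\<Union>i<n. R i)" using x by (auto simp: R_def)
  qed
  have "emeasure M (B - blocks n B D) \<le> emeasure M (\<Union>i<n. R i)"
    using left by (intro emeasure_mono) auto
  also have "\<dots> \<le> (\<Sum>i<n. emeasure M (R i))"
    by (intro emeasure_subadditive_finite) auto
  also have "\<dots> \<le> (\<Sum>i<n. emeasure M C)" by (intro sum_mono R_le)
  also have "\<dots> = of_nat n * emeasure M C" by simp
  finally show ?thesis
    using vt vt_mono ret D_sets
    by (intro exI[of _ D]) (auto simp: block_base_def blocks_def D_def)
qed

end

text \<open>For a free point \<open>x\<close> the set of its first \<open>N\<close> forward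
  translates is finite, hence closed, and misses \<open>x\<close>; some basic open set around
  \<open>x\<close> avoids it. The cover consists of the basic open sets, each without the points
  that return to it within \<open>N\<close> steps.\<close>

lemma exists_separating_cover:
  fixes \<sigma> :: "int \<Rightarrow> 'a \<Rightarrow> 'a::{second_countable_topology, t1_space}"
  assumes [measurable]: "\<And>j. \<sigma> j \<in> borel_measurable borel"
  shows "\<exists>E :: nat \<Rightarrow> 'a set. (\<forall>m. E m \<in> sets borel) \<and>
     (\<forall>m x j. x \<in> E m \<longrightarrow> 1 \<le> j \<longrightarrow> j \<le> N \<longrightarrow> \<sigma> j x \<notin> E m) \<and>
     {x. \<forall>j. j \<noteq> 0 \<longrightarrow> \<sigma> j x \<noteq> x} \<subseteq> (\<Union>m. E m)"
proof -
  obtain \<B> :: "'a set set" where \<B>: "countable \<B>" "topological_basis \<B>"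
    using ex_countable_basis by auto
  have "\<B> \<noteq> {}"
  proof
    assume "\<B> = {}"
    then show False using topological_basisE[OF \<B>(2) open_UNIV UNIV_I] by auto
  qed
  define U where "U = from_nat_into \<B>"
  have U: "range U = \<B>" using \<B> \<open>\<B> \<noteq> {}\<close> by (simp add: U_def range_from_nat_into)
  have "open (U m)" for m using topological_basis_open[OF \<B>(2), of "U m"] U by auto
  then have [measurable]: "U m \<in> sets borel" for m by auto
  define E where "E m = {x \<in> space borel. x \<in> U m \<and> (\<forall>j\<in>{1..N}. \<sigma> j x \<notin> U m)}" for m
  have "E m \<in> sets borel" for m unfolding E_def by measurable
  moreover have "x \<in> (\<Union>m. E m)" if "\<forall>j. j \<noteq> 0 \<longrightarrow> \<sigma> j x \<noteq> x" for x
  proof -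
    have "open (- (\<lambda>j. \<sigma> j x) ` {1..N})"
      by (intro open_Compl finite_imp_closed) auto
    moreover have "x \<in> - (\<lambda>j. \<sigma> j x) ` {1..N}" using that by (auto simp: image_iff dest!: sym[of x])
    ultimately obtain b where "b \<in> \<B>" "x \<in> b" "b \<subseteq> - (\<lambda>j. \<sigma> j x) ` {1..N}"
      using topological_basisE[OF \<B>(2)] by metis
    moreover obtain m where "b = U m" using \<open>b \<in> \<B>\<close> U by auto
    ultimately have "x \<in> E m" by (auto simp: E_def)
    then show ?thesis by auto
  qed
  ultimately show ?thesis by (intro exI[of _ E]) (auto simp: E_def)
qed

section \<open>Cycles from blocks\<close>

context pmp_int_action
begin

text \<open>The cocycle is the gap to the next position of the block, with wrap-around at the end.
  The times \<open>k\<close> stay abstract because they will be glued from infinitely many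
  stages.\<close>

lemma exists_cycle_cocycle:
  fixes k :: "nat \<Rightarrow> 'a \<Rightarrow> nat"
  assumes [measurable]: "D \<in> sets M" "\<And>i. k i \<in> M \<rightarrow>\<^sub>M count_space UNIV"
    and inj: "inj_on (\<lambda>(i, x). \<sigma> (int (k i x)) x) ({..<n} \<times> D)"
  shows "\<exists>c. c \<in> M \<rightarrow>\<^sub>M count_space UNIV \<and>
    (\<forall>i<n. \<forall>x\<in>D. c (\<sigma> (int (k i x)) x) = int (k (Suc i mod n) x) - int (k i x)) \<and>
    (\<forall>y. y \<notin> (\<Union>i<n. (\<lambda>x. \<sigma> (int (k i x)) x) ` D) \<longrightarrow> c y = 0)"
proof -
  define F where "F = (\<lambda>(i, x). \<sigma> (int (k i x)) x)"
  define I where "I = (\<Union>i<n. (\<lambda>x. \<sigma> (int (k i x)) x) ` D)"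
  define d where "d = (\<lambda>(i, x). int (k (Suc i mod n) x) - int (k i x))"
  define c where "c y = (if y \<in> I then d (inv_into ({..<n} \<times> D) F y) else 0)" for y
  have [measurable]: "I \<in> sets M" unfolding I_def by measurable
  have c: "c (\<sigma> (int (k i x)) x) = int (k (Suc i mod n) x) - int (k i x)" if "i < n" "x \<in> D" for i x
  proof -
    have "inv_into ({..<n} \<times> D) F (F (i, x)) = (i, x)"
      using inj that by (intro inv_into_f_f) (auto simp: F_def)
    moreover have "\<sigma> (int (k i x)) x \<in> I" using that by (auto simp: I_def)
    ultimately show ?thesis by (simp add: c_def F_def d_def)
  qed
  \<comment> \<open>\<open>inv_into\<close> gives no measurability by itself. On the blocks,
    however, the value \<open>z\<close> is taken exactly on the images of the base points whose gap
    is \<open>z\<close>, and such images are measurable.\<close>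
  have "c -` {z} \<inter> space M \<in> sets M" for z
  proof -
    define J where "J = (\<Union>i<n. (\<lambda>x. \<sigma> (int (k i x)) x) ` {x \<in> space M. x \<in> D \<and> int (k (Suc i mod n) x) - int (k i x) = z})"
    have "J \<in> sets M" unfolding J_def by measurable
    moreover have "c -` {z} \<inter> space M = J \<union> (if z = 0 then space M - I else {})"
    proof (intro set_eqI)
      fix y
      show "y \<in> c -` {z} \<inter> space M \<longleftrightarrow> y \<in> J \<union> (if z = 0 then space M - I else {})"
      proof (cases "y \<in> I")
        case True
        then obtain i x where ix: "i < n" "x \<in> D" "y = \<sigma> (int (k i x)) x" by (auto simp: I_def)
        have "y \<in> J \<longleftrightarrow> c y = z"
        proof
          assume "y \<in> J"
          then show "c y = z" using c by (auto simp: J_def)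
        next
          assume "c y = z"
          then show "y \<in> J" using ix c[of i x] by (auto simp: J_def)
        qed
        then show ?thesis using True by auto
      next
        case False
        moreover have "J \<subseteq> I" by (auto simp: J_def I_def)
        ultimately show ?thesis by (auto simp: c_def)
      qed
    qed
    ultimately show ?thesis by (auto simp del: space_UNIV intro!: sets.Un sets.Diff)
  qed
  then have "c \<in> M \<rightarrow>\<^sub>M count_space UNIV"
    by (subst measurable_count_space_eq2_countable) auto
  then show ?thesis using c by (intro exI[of _ c]) (auto simp: c_def I_def)
qed

text \<open>Off the blocks \<open>c0\<close> and \<open>g0\<close> make the integrand vanish; the
  rest splits over the \<open>n\<close> positions, each carried back to the base by
  \<open>nn_integral_act_image\<close>.\<close>

lemma nn_integral_cycle_cocycle_le:
  fixes k :: "nat \<Rightarrow> 'a \<Rightarrow> nat" and g :: "int \<Rightarrow> ennreal"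
  assumes [measurable]: "D \<in> sets M" "\<And>i. k i \<in> M \<rightarrow>\<^sub>M count_space UNIV" "c \<in> M \<rightarrow>\<^sub>M count_space UNIV"
    and inj: "inj_on (\<lambda>(i, x). \<sigma> (int (k i x)) x) ({..<n} \<times> D)"
    and c: "\<And>i x. i < n \<Longrightarrow> x \<in> D \<Longrightarrow> c (\<sigma> (int (k i x)) x) = int (k (Suc i mod n) x) - int (k i x)"
    and c0: "\<And>y. y \<notin> (\<Union>i<n. (\<lambda>x. \<sigma> (int (k i x)) x) ` D) \<Longrightarrow> c y = 0"
    and g0: "g 0 = 0"
  shows "(\<integral>\<^sup>+ y. g (c y) \<partial>M) \<le> (\<Sum>i<n. \<integral>\<^sup>+ x\<in>D. g (int (k (Suc i mod n) x) - int (k i x)) \<partial>M)"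
proof -
  define f where "f i = (\<lambda>x. \<sigma> (int (k i x)) x)" for i
  have f_sets [measurable]: "f i ` D \<in> sets M" for i unfolding f_def by measurable
  have [measurable]: "g \<in> borel_measurable (count_space UNIV)" by simp
  have inj_f: "inj_on (f i) D" if "i < n" for i
    using inj that by (auto simp: inj_on_def f_def)
  have "g (c y) \<le> (\<Sum>i<n. g (c y) * indicator (f i ` D) y)" for y
  proof (cases "y \<in> (\<Union>i<n. f i ` D)")
    case True
    then obtain i where i: "i < n" "y \<in> f i ` D" by auto
    have "g (c y) = g (c y) * indicator (f i ` D) y" using i by simp
    also have "\<dots> \<le> (\<Sum>i<n. g (c y) * indicator (f i ` D) y)"
      using i by (intro member_le_sum) auto
    finally show ?thesis .
  next
    case False
    then show ?thesis using c0[of y] g0 by (simp add: f_def)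
  qed
  then have "(\<integral>\<^sup>+ y. g (c y) \<partial>M) \<le> (\<integral>\<^sup>+ y. (\<Sum>i<n. g (c y) * indicator (f i ` D) y) \<partial>M)"
    by (intro nn_integral_mono)
  also have "\<dots> = (\<Sum>i<n. \<integral>\<^sup>+ y\<in>f i ` D. g (c y) \<partial>M)"
    by (intro nn_integral_sum) measurable
  also have "\<dots> = (\<Sum>i<n. \<integral>\<^sup>+ x\<in>D. g (c (f i x)) \<partial>M)"
    unfolding f_def using inj_f
    by (intro sum.cong refl nn_integral_act_image[symmetric]) (auto simp: f_def)
  also have "\<dots> = (\<Sum>i<n. \<integral>\<^sup>+ x\<in>D. g (int (k (Suc i mod n) x) - int (k i x)) \<partial>M)"
    using c by (intro sum.cong refl nn_integral_cong) (auto simp: f_def indicator_def)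
  finally show ?thesis .
qed

end

text \<open>Negative powers of \<open>P\<close> are powers of \<open>P ^^ (n - 1)\<close>, so
  two-sided orbits reduce to forward ones.\<close>

lemma ipow_orbit_of_finite_order:
  assumes "space M = UNIV" and P: "P ^^ n = id" and "0 < n"
  shows "the_inv_into (space M) P = P ^^ (n - 1)"
    and "{ipow M P k y | k. True} = range (\<lambda>m. (P ^^ m) y)"
proof -
  have P_comp: "P ((P ^^ (n - 1)) x) = x" "(P ^^ (n - 1)) (P x) = x" for x
    using P \<open>0 < n\<close> by (cases n; auto simp: fun_eq_iff funpow_swap1)+
  have "inj P" using P_comp(2) by (metis injI)
  show inv: "the_inv_into (space M) P = P ^^ (n - 1)"
    using \<open>inj P\<close> P_comp assms(1) by (auto simp: fun_eq_iff intro!: the_inv_into_f_eq)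
  have "\<exists>m. ipow M P k y = (P ^^ m) y" for k
    by (cases "0 \<le> k") (auto simp: ipow_def inv funpow_mult)
  moreover have "(P ^^ m) y = ipow M P (int m) y" for m by (simp add: ipow_def)
  ultimately show "{ipow M P k y | k. True} = range (\<lambda>m. (P ^^ m) y)"
    by blast
qed

context pmp_int_action
begin

text \<open>\<open>P\<close> rotates each block and fixes all other points, so
  \<open>P ^^ n = id\<close> holds everywhere. This gives bijectivity and a measurable inverse at
  once, and the orbits are the blocks and single points.\<close>

lemma cycle_of_cocycle:
  fixes k :: "nat \<Rightarrow> 'a \<Rightarrow> nat"
  assumes n: "2 \<le> n"
    and [measurable]: "D \<in> sets M" "\<And>i. k i \<in> M \<rightarrow>\<^sub>M count_space UNIV" "c \<in> M \<rightarrow>\<^sub>M count_space UNIV"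
    and inj: "inj_on (\<lambda>(i, x). \<sigma> (int (k i x)) x) ({..<n} \<times> D)"
    and c: "\<And>i x. i < n \<Longrightarrow> x \<in> D \<Longrightarrow> c (\<sigma> (int (k i x)) x) = int (k (Suc i mod n) x) - int (k i x)"
    and c0: "\<And>y. y \<notin> (\<Union>i<n. (\<lambda>x. \<sigma> (int (k i x)) x) ` D) \<Longrightarrow> c y = 0"
    and P_def: "P = (\<lambda>y. \<sigma> (c y) y)"
  shows "aut M P" "is_n_cycle M n P"
    and "P y \<noteq> y \<longleftrightarrow> y \<in> (\<Union>i<n. (\<lambda>x. \<sigma> (int (k i x)) x) ` D)"
proof -
  define f where "f i x = \<sigma> (int (k i x)) x" for i x
  have f_inj: "i = j" if "f i x = f j x" "i < n" "j < n" "x \<in> D" for i j x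
    using inj that by (auto simp: inj_on_def f_def)
  have [measurable]: "P \<in> M \<rightarrow>\<^sub>M M" unfolding P_def by measurable
  have P_f: "P (f i x) = f (Suc i mod n) x" if "i < n" "x \<in> D" for i x
    using that c[of i x] by (simp add: P_def f_def flip: act_add)
  have Pm_f: "(P ^^ m) (f i x) = f ((i + m) mod n) x" if "i < n" "x \<in> D" for i x m
  proof (induction m)
    case (Suc m)
    then show ?case using P_f[of "(i + m) mod n" x] that n by (simp add: mod_Suc_eq)
  qed (use that in simp)
  have in_blocks: "\<exists>i<n. \<exists>x\<in>D. y = f i x" if "y \<in> (\<Union>i<n. (\<lambda>x. \<sigma> (int (k i x)) x) ` D)" for y
    using that by (auto simp: f_def)
  have fixed: "P y = y" if "y \<notin> (\<Union>i<n. (\<lambda>x. \<sigma> (int (k i x)) x) ` D)" for y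
    using c0[OF that] by (simp add: P_def)
  have fixed_m: "(P ^^ m) y = y" if "y \<notin> (\<Union>i<n. (\<lambda>x. \<sigma> (int (k i x)) x) ` D)" for y m
    using fixed[OF that] by (induction m) auto
  have Pn: "P ^^ n = id"
  proof
    fix y show "(P ^^ n) y = id y"
      using in_blocks[of y] fixed_m[of y n] Pm_f n by fastforce
  qed
  note inv = ipow_orbit_of_finite_order[OF space_UNIV Pn]
  have "bij P"
  proof (rule o_bij)
    show "P \<circ> (P ^^ (n - 1)) = id" "(P ^^ (n - 1)) \<circ> P = id"
      using Pn n by (cases n; simp add: funpow_Suc_right del: funpow.simps; simp add: funpow_swap1 fun_eq_iff)+
  qed
  moreover have "P ^^ m \<in> M \<rightarrow>\<^sub>M M" for m
    by (rule measurable_compose_n) measurable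
  moreover have "distr M M P = M"
    using distr_act_cocycle[of c] \<open>bij P\<close> by (simp add: P_def)
  ultimately show "aut M P"
    using inv(1) n by (auto simp: aut_def)
  have orbit: "range (\<lambda>m. (P ^^ m) (f i x)) = (\<lambda>j. f j x) ` {..<n}" if "i < n" "x \<in> D" for i x
  proof -
    have "f j x = (P ^^ (n - i + j)) (f i x)" if "j < n" for j
      using that \<open>i < n\<close> \<open>x \<in> D\<close> by (simp add: Pm_f)
    then have "(\<lambda>j. f j x) ` {..<n} \<subseteq> range (\<lambda>m. (P ^^ m) (f i x))" by auto
    moreover have "range (\<lambda>m. (P ^^ m) (f i x)) \<subseteq> (\<lambda>j. f j x) ` {..<n}"
      using that n by (auto simp: Pm_f)
    ultimately show ?thesis by (rule subset_antisym[rotated])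
  qed
  have "finite (range (\<lambda>m. (P ^^ m) y)) \<and> card (range (\<lambda>m. (P ^^ m) y)) \<in> {1, n}" for y
  proof (cases "y \<in> (\<Union>i<n. (\<lambda>x. \<sigma> (int (k i x)) x) ` D)")
    case True
    then obtain i x where ix: "i < n" "x \<in> D" "y = f i x" using in_blocks by blast
    have "inj_on (\<lambda>j. f j x) {..<n}" using f_inj ix by (auto simp: inj_on_def)
    then show ?thesis unfolding ix(3) orbit[OF ix(1,2)] by (simp add: card_image)
  next
    case False
    then have "range (\<lambda>m. (P ^^ m) y) = {y}" using fixed_m by auto
    then show ?thesis by simp
  qed
  then show "is_n_cycle M n P"
    using \<open>aut M P\<close> inv(2) n by (simp add: is_n_cycle_def)
  show "P y \<noteq> y \<longleftrightarrow> y \<in> (\<Union>i<n. (\<lambda>x. \<sigma> (int (k i x)) x) ` D)"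
  proof
    assume "y \<in> (\<Union>i<n. (\<lambda>x. \<sigma> (int (k i x)) x) ` D)"
    then obtain i x where ix: "i < n" "x \<in> D" "y = f i x" using in_blocks by blast
    have "Suc i mod n \<noteq> i" using ix n by (cases "Suc i = n") auto
    then show "P y \<noteq> y" using f_inj[of "Suc i mod n" x i] ix n by (auto simp: P_f)
  qed (use fixed in blast)
qed

section \<open>Exhausting a set by successive block bases\<close>

lemma exists_exhausting_block_bases:
  assumes step: "\<And>B \<epsilon>. B \<in> sets M \<Longrightarrow> B \<subseteq> free_part \<Longrightarrow> 0 < \<epsilon> \<Longrightarrow>
      \<exists>D. block_base n B D \<and> emeasure M (B - blocks n B D) \<le> ennreal \<epsilon>"
    and A: "A \<in> sets M" "A \<subseteq> free_part" and \<epsilon>: "\<And>m. 0 < \<epsilon> m"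
  shows "\<exists>B D. B 0 = A \<and> (\<forall>m. B m \<in> sets M \<and> block_base n (B m) (D m) \<and>
     B (Suc m) = B m - blocks n (B m) (D m) \<and> emeasure M (B (Suc m)) \<le> ennreal (\<epsilon> (Suc m)))"
proof -
  obtain \<Delta> where \<Delta>: "block_base n B (\<Delta> B e) \<and> emeasure M (B - blocks n B (\<Delta> B e)) \<le> ennreal e"
    if "B \<in> sets M" "B \<subseteq> free_part" "0 < e" for B e
    using step by metis
  \<comment> \<open>Stage \<open>m\<close> runs with tolerance \<open>\<epsilon> (Suc m)\<close>,
    because its remainder is the input of stage \<open>Suc m\<close>, whose cost dictates how small
    it must be.\<close>
  define B where "B = rec_nat A (\<lambda>m C. C - blocks n C (\<Delta> C (\<epsilon> (Suc m))))"
  have B_0: "B 0 = A" and B_Suc: "B (Suc m) = B m - blocks n (B m) (\<Delta> (B m) (\<epsilon> (Suc m)))" for m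
    by (simp_all add: B_def)
  have B: "B m \<in> sets M \<and> B m \<subseteq> free_part" for m
  proof (induction m)
    case (Suc m)
    then have [measurable]: "B m \<in> sets M" by simp
    have [measurable]: "\<Delta> (B m) (\<epsilon> (Suc m)) \<in> sets M"
      using \<Delta>[of "B m" "\<epsilon> (Suc m)"] Suc \<epsilon> by (auto simp: block_base_def)
    have "B m - blocks n (B m) (\<Delta> (B m) (\<epsilon> (Suc m))) \<in> sets M"
      unfolding blocks_def by measurable
    then show ?case using Suc by (auto simp: B_Suc)
  qed (use A B_0 in simp)
  show ?thesis
    using B \<Delta> \<epsilon> by (intro exI[of _ B] exI[of _ "\<lambda>m. \<Delta> (B m) (\<epsilon> (Suc m))"]) (auto simp: B_0 B_Suc)
qed

lemma block_base_visit_time_le: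
  assumes "block_base n B D" "x \<in> D" "i < n"
  shows "visit_time B i x \<le> visit_time B (n - 1) x"
proof (cases "i = n - 1")
  case False
  then have "i < n - 1" "n - 1 < n" using assms by auto
  then show ?thesis using assms unfolding block_base_def by (meson less_imp_le)
qed simp

text \<open>If the time from \<open>x\<close> were larger than that from \<open>y\<close>, then
  \<open>y\<close> would be a point of \<open>D\<close> on the orbit segment of the block of
  \<open>x\<close>, against the return condition. Equal times give equal base points, and strict
  increase then gives equal positions.\<close>

lemma block_base_inj:
  assumes D: "block_base n B D" and x: "x \<in> D" "y \<in> D" and "i < n" "j < n"
    and eq: "\<sigma> (int (visit_time B i x)) x = \<sigma> (int (visit_time B j y)) y"
  shows "x = y \<and> i = j"
proof -
  have less: "visit_time B i x < visit_time B j x" if "x \<in> D" "i < j" "j < n" for x i j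
    using D that unfolding block_base_def by blast
  have ret: "\<sigma> (int d) x \<notin> D" if "x \<in> D" "1 \<le> d" "d \<le> visit_time B (n - 1) x" for x d
    using D that unfolding block_base_def by blast
  have *: "visit_time B i x \<le> visit_time B j y"
    if "x \<in> D" "y \<in> D" "i < n" "\<sigma> (int (visit_time B i x)) x = \<sigma> (int (visit_time B j y)) y" for x y i j
  proof (rule ccontr)
    assume gt: "\<not> visit_time B i x \<le> visit_time B j y"
    have "\<sigma> (int (visit_time B i x - visit_time B j y)) x = y"
      using act_diff[OF that(4)] gt by (simp add: of_nat_diff)
    moreover have "visit_time B i x - visit_time B j y \<le> visit_time B (n - 1) x"
      using block_base_visit_time_le[OF D that(1,3)] by simp
    moreover have "1 \<le> visit_time B i x - visit_time B j y" using gt by simp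
    ultimately show False using ret[OF that(1)] that(2) by metis
  qed
  have vt: "visit_time B i x = visit_time B j y"
    using *[OF x(1,2) \<open>i < n\<close> eq] *[OF x(2,1) \<open>j < n\<close> eq[symmetric]] by (rule antisym)
  then have "x = y" using act_diff[OF eq] by simp
  moreover have "i = j"
    using less[of x i j] less[of x j i] vt x \<open>x = y\<close> \<open>i < n\<close> \<open>j < n\<close>
    by (cases i j rule: linorder_cases) auto
  ultimately show ?thesis by simp
qed

lemma base_subset_blocks:
  assumes "block_base n B D" "0 < n"
  shows "D \<subseteq> blocks n B D"
proof
  fix x assume "x \<in> D"
  then have "x \<in> B" using assms by (auto simp: block_base_def)
  then have "visit_time B 0 x = 0" by (intro visit_time_eq) auto
  then have "x = \<sigma> (int (visit_time B 0 x)) x" by simp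
  then show "x \<in> blocks n B D" using \<open>x \<in> D\<close> \<open>0 < n\<close> unfolding blocks_def by blast
qed

end

section \<open>Cost and exhaustion\<close>

text \<open>Beyond some \<open>u\<close> sublinearity gives \<open>\<phi> s < \<delta> * s\<close>,
  and up to \<open>u\<close> monotonicity gives \<open>\<phi> s \<le> \<phi> u\<close>; so
  \<open>b = \<phi> u\<close> suffices.\<close>

lemma sublinear_affine_bound:
  assumes "metric_compatible \<phi>" "sublinear \<phi>" "0 < \<delta>"
  shows "\<exists>b\<ge>0. \<forall>s\<ge>0. \<phi> s \<le> b + \<delta> * s"
proof -
  have \<phi>: "0 \<le> \<phi> t" "mono_on {0..} \<phi>" if "0 \<le> t" for t
    using assms that by (auto simp: metric_compatible_def)
  have "eventually (\<lambda>t. \<phi> t / t < \<delta>) at_top"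
    using assms by (auto simp: sublinear_def intro: order_tendstoD)
  then obtain t where t: "\<And>s. t \<le> s \<Longrightarrow> \<phi> s / s < \<delta>"
    by (auto simp: eventually_at_top_linorder)
  define u where "u = max t 1"
  have "\<phi> s \<le> \<phi> u + \<delta> * s" if "0 \<le> s" for s
  proof (cases "s \<le> u")
    case True
    then have "\<phi> s \<le> \<phi> u" using \<phi>(2)[of 0] that by (auto simp: mono_on_def)
    then show ?thesis using that assms by (simp add: add_increasing2)
  next
    case False
    then have "\<phi> s / s < \<delta>" "0 < s" using t[of s] by (auto simp: u_def)
    then have "\<phi> s < \<delta> * s" by (simp add: field_simps)
    moreover have "0 \<le> \<phi> u" using \<phi>(1) by (simp add: u_def)
    ultimately show ?thesis by simp
  qed
  moreover have "0 \<le> \<phi> u" using \<phi>(1) by (simp add: u_def)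
  ultimately show ?thesis by blast
qed

context pmp_int_action
begin

text \<open>Kac bounds the total length of the blocks by 1, so the linear term costs at most
  \<open>\<delta>\<close> however long they are; only the constant term scales with the measure of
  \<open>B\<close>.\<close>

lemma nn_integral_block_length_le:
  assumes D: "block_base n B D" and [measurable]: "B \<in> sets M"
    and b: "0 \<le> b" "0 \<le> \<delta>" "\<And>s. 0 \<le> s \<Longrightarrow> \<phi> s \<le> b + \<delta> * s"
  shows "(\<integral>\<^sup>+ x\<in>D. ennreal (\<phi> (real (visit_time B (n - 1) x))) \<partial>M)
       \<le> ennreal b * emeasure M B + ennreal \<delta>"
proof -
  define K where "K = visit_time B (n - 1)"
  have [measurable]: "D \<in> sets M" "K \<in> M \<rightarrow>\<^sub>M count_space UNIV"
    using D by (auto simp: block_base_def K_def)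
  have "(\<integral>\<^sup>+ x\<in>D. ennreal (\<phi> (real (K x))) \<partial>M)
      \<le> (\<integral>\<^sup>+ x. ennreal b * indicator D x + ennreal \<delta> * (of_nat (K x + 1) * indicator D x) \<partial>M)"
  proof (intro nn_integral_mono)
    fix x
    have "\<phi> (real (K x)) \<le> b + \<delta> * real (K x)" using b(3) by simp
    \<comment> \<open>A time span \<open>K x\<close> covers \<open>K x + 1\<close> orbit points, the
      quantity in \<open>kac_inequality\<close>.\<close>
    also have "\<dots> \<le> b + \<delta> * real (K x + 1)" using b by (intro add_left_mono mult_left_mono) auto
    finally have "ennreal (\<phi> (real (K x))) \<le> ennreal (b + \<delta> * real (K x + 1))"
      by (rule ennreal_leI)
    also have "\<dots> = ennreal b + ennreal \<delta> * ennreal (real (K x + 1))"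
      using b(1,2) by (subst ennreal_mult[symmetric]) (auto simp: ennreal_plus)
    also have "\<dots> = ennreal b + ennreal \<delta> * of_nat (K x + 1)"
      by (simp only: ennreal_of_nat_eq_real_of_nat)
    finally show "ennreal (\<phi> (real (K x))) * indicator D x
        \<le> ennreal b * indicator D x + ennreal \<delta> * (of_nat (K x + 1) * indicator D x)"
      by (auto simp: indicator_def)
  qed
  also have "\<dots> = ennreal b * emeasure M D + ennreal \<delta> * (\<integral>\<^sup>+ x\<in>D. of_nat (K x + 1) \<partial>M)"
    by (subst nn_integral_add) (auto simp: nn_integral_cmult nn_integral_cmult_indicator)
  also have "\<dots> \<le> ennreal b * emeasure M B + ennreal \<delta> * 1"
  proof (intro add_mono mult_left_mono)
    show "emeasure M D \<le> emeasure M B" using D by (intro emeasure_mono) (auto simp: block_base_def)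
    show "(\<integral>\<^sup>+ x\<in>D. of_nat (K x + 1) \<partial>M) \<le> 1"
      using D by (intro kac_inequality) (auto simp: block_base_def K_def)
  qed auto
  finally show ?thesis by (simp add: K_def)
qed

text \<open>Instead of composing infinitely many cycles, the bases of all stages are merged into one
  base \<open>E\<close> carrying a single cycle. The hypothesis \<open>step\<close> isolates the
  part of the argument that uses topology.\<close>

lemma exists_cycle_with_support:
  assumes \<phi>: "metric_compatible \<phi>" "sublinear \<phi>" and n: "2 \<le> n"
    and step: "\<And>B \<epsilon>. B \<in> sets M \<Longrightarrow> B \<subseteq> free_part \<Longrightarrow> 0 < \<epsilon> \<Longrightarrow>
      \<exists>D. block_base n B D \<and> emeasure M (B - blocks n B D) \<le> ennreal \<epsilon>"
    and A: "A \<in> sets M" "A \<subseteq> free_part"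
  shows "\<exists>c. c \<in> M \<rightarrow>\<^sub>M count_space UNIV \<and> is_n_cycle M n (\<lambda>y. \<sigma> (c y) y) \<and>
     (\<integral>\<^sup>+ y. ennreal (\<phi> (real_of_int \<bar>c y\<bar>)) \<partial>M) < \<infinity> \<and>
     (AE y in M. \<sigma> (c y) y \<noteq> y \<longleftrightarrow> y \<in> A)"
proof -
  \<comment> \<open>Stage \<open>m\<close> uses slope \<open>(1/2)^m\<close>, so the linear terms
    are summable whatever the constants \<open>b m\<close> are.\<close>
  have "\<exists>b\<ge>0. \<forall>s\<ge>0. \<phi> s \<le> b + (1/2)^m * s" for m :: nat
    using \<phi> by (intro sublinear_affine_bound) auto
  then obtain b :: "nat \<Rightarrow> real" where b: "\<And>m. 0 \<le> b m" "\<And>m s. 0 \<le> s \<Longrightarrow> \<phi> s \<le> b m + (1/2)^m * s"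
    by metis
  \<comment> \<open>Chosen so that \<open>\<epsilon> m\<close> and \<open>b m * \<epsilon> m\<close>
    are both at most \<open>(1/2)^m\<close>: the first makes the remainders shrink to a null set,
    the second makes the constant terms summable.\<close>
  define \<epsilon> where "\<epsilon> m = (1/2)^m / (1 + b m)" for m
  have \<epsilon>_pos: "0 < \<epsilon> m" for m using b(1)[of m] by (simp add: \<epsilon>_def)
  have \<epsilon>_le: "\<epsilon> m \<le> (1/2)^m" for m
    using b(1)[of m] by (simp add: \<epsilon>_def divide_le_eq mult_le_cancel_left1)
  have b\<epsilon>: "b m * \<epsilon> m \<le> (1/2)^m" for m
  proof -
    have "b m * (1/2)^m \<le> (1/2)^m * (1 + b m)" by (simp add: algebra_simps)
    then show ?thesis using b(1)[of m] by (simp add: \<epsilon>_def divide_le_eq)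
  qed
  have "\<exists>B D. B 0 = A \<and> (\<forall>m. B m \<in> sets M \<and> block_base n (B m) (D m) \<and>
     B (Suc m) = B m - blocks n (B m) (D m) \<and> emeasure M (B (Suc m)) \<le> ennreal (\<epsilon> (Suc m)))"
    by (intro exists_exhausting_block_bases step A \<epsilon>_pos)
  then obtain B D where B_0: "B 0 = A" and BD: "\<forall>m. B m \<in> sets M \<and> block_base n (B m) (D m) \<and>
     B (Suc m) = B m - blocks n (B m) (D m) \<and> emeasure M (B (Suc m)) \<le> ennreal (\<epsilon> (Suc m))"
    by (elim exE conjE)
  have B_sets [measurable]: "B m \<in> sets M" and D: "block_base n (B m) (D m)"
    and B_Suc: "B (Suc m) = B m - blocks n (B m) (D m)"
    and B_le: "emeasure M (B (Suc m)) \<le> ennreal (\<epsilon> (Suc m))" for m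
    using BD by blast+
  have D_sets [measurable]: "D m \<in> sets M" for m using D[of m] by (simp add: block_base_def)
  have B_antimono: "B m' \<subseteq> B m" if "m \<le> m'" for m m'
    using that by (induction rule: dec_induct) (auto simp: B_Suc)
  have blocks_disj: "m = m'" if "y \<in> blocks n (B m) (D m)" "y \<in> blocks n (B m') (D m')" for m m' y
  proof -
    have *: False if "y \<in> blocks n (B m) (D m)" "y \<in> blocks n (B m') (D m')" "m < m'" for m m'
    proof -
      have "y \<in> B m'" using that D[of m'] by (auto simp: block_base_def)
      then have "y \<in> B (Suc m)" using B_antimono[of "Suc m" m'] that by auto
      then show False using that by (simp add: B_Suc)
    qed
    then show ?thesis using that by (cases m m' rule: linorder_cases) auto
  qed
  have D_blocks: "D m \<subseteq> blocks n (B m) (D m)" for m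
    using base_subset_blocks[OF D] n by simp
  define E where "E = (\<Union>m. D m)"
  \<comment> \<open>The bases are disjoint, so for \<open>x\<close> in \<open>E\<close> this is the
    one stage whose base contains \<open>x\<close>; \<open>LEAST\<close> makes it measurable, and
    through it the times of all stages combine into \<open>k\<close>.\<close>
  define l where "l x = (LEAST m. x \<in> D m)" for x
  define k where "k i x = visit_time (B (l x)) i x" for i x
  have [measurable]: "E \<in> sets M" unfolding E_def by measurable
  have [measurable]: "l \<in> M \<rightarrow>\<^sub>M count_space UNIV" unfolding l_def[abs_def] by measurable
  have k_meas [measurable]: "k i \<in> M \<rightarrow>\<^sub>M count_space UNIV" for i
    unfolding k_def[abs_def] by (rule measurable_compose_countable[where g=l and f="\<lambda>m x. visit_time (B m) i x"]) auto
  have l: "l x = m" if "x \<in> D m" for x m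
  proof -
    have "x \<in> D (l x)" unfolding l_def using that by (rule LeastI)
    then show ?thesis using blocks_disj[of x "l x" m] D_blocks that by blast
  qed
  have k: "k i x = visit_time (B m) i x" if "x \<in> D m" for i x m
    by (simp add: k_def l[OF that])
  have k_le: "k i x \<le> k (n - 1) x" if "x \<in> E" "i < n" for i x
  proof -
    obtain m where m: "x \<in> D m" using \<open>x \<in> E\<close> by (auto simp: E_def)
    show ?thesis using block_base_visit_time_le[OF D m \<open>i < n\<close>] by (simp add: k[OF m])
  qed
  have inj: "inj_on (\<lambda>(i, x). \<sigma> (int (k i x)) x) ({..<n} \<times> E)"
  proof (rule inj_onI, clarify)
    fix i x j y
    assume ij: "i < n" "j < n" and "x \<in> E" "y \<in> E" and eq: "\<sigma> (int (k i x)) x = \<sigma> (int (k j y)) y"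
    then obtain m m' where m: "x \<in> D m" "y \<in> D m'" by (auto simp: E_def)
    have "\<sigma> (int (k i x)) x \<in> blocks n (B m) (D m)"
      unfolding blocks_def k[OF m(1)] using ij m by blast
    moreover have "\<sigma> (int (k j y)) y \<in> blocks n (B m') (D m')"
      unfolding blocks_def k[OF m(2)] using ij m by blast
    ultimately have "m' = m" using eq blocks_disj by metis
    then show "i = j \<and> x = y"
      using block_base_inj[OF D[of m], of x y i j] m ij eq by (simp add: k[OF m(1)] k[OF m(2)])
  qed
  have img: "(\<lambda>x. \<sigma> (int (k i x)) x) ` D m = (\<lambda>x. \<sigma> (int (visit_time (B m) i x)) x) ` D m" for i m
    by (intro image_cong) (auto simp: k)
  have union: "(\<Union>i<n. (\<lambda>x. \<sigma> (int (k i x)) x) ` E) = (\<Union>m. blocks n (B m) (D m))"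
    unfolding E_def blocks_def image_UN img by (rule SUP_commute)
  obtain c where c [measurable]: "c \<in> M \<rightarrow>\<^sub>M count_space UNIV"
    and c_eq: "\<And>i x. i < n \<Longrightarrow> x \<in> E \<Longrightarrow> c (\<sigma> (int (k i x)) x) = int (k (Suc i mod n) x) - int (k i x)"
    and c_0: "\<And>y. y \<notin> (\<Union>i<n. (\<lambda>x. \<sigma> (int (k i x)) x) ` E) \<Longrightarrow> c y = 0"
    using exists_cycle_cocycle[OF \<open>E \<in> sets M\<close> k_meas inj] by blast
  have cycle: "is_n_cycle M n (\<lambda>y. \<sigma> (c y) y)"
    by (rule cycle_of_cocycle[OF n \<open>E \<in> sets M\<close> k_meas c inj _ _ refl]) (fact c_eq c_0)+
  have support: "\<sigma> (c y) y \<noteq> y \<longleftrightarrow> y \<in> (\<Union>i<n. (\<lambda>x. \<sigma> (int (k i x)) x) ` E)" for y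
    by (rule cycle_of_cocycle[OF n \<open>E \<in> sets M\<close> k_meas c inj _ _ refl]) (fact c_eq c_0)+
  have \<phi>_mono: "\<phi> s \<le> \<phi> t" if "0 \<le> s" "s \<le> t" for s t
    using \<phi>(1) that by (auto simp: metric_compatible_def mono_on_def)

  have "(\<integral>\<^sup>+ y. ennreal (\<phi> (real_of_int \<bar>c y\<bar>)) \<partial>M)
      \<le> (\<Sum>i<n. \<integral>\<^sup>+ x\<in>E. ennreal (\<phi> (real_of_int \<bar>int (k (Suc i mod n) x) - int (k i x)\<bar>)) \<partial>M)"
    using \<phi>(1)
    by (intro nn_integral_cycle_cocycle_le[where g="\<lambda>z. ennreal (\<phi> (real_of_int \<bar>z\<bar>))"] c_eq c_0 c inj)
      (auto simp: metric_compatible_def)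
  \<comment> \<open>Both times lie between 0 and the last visit time of the block, so every jump,
    including the one back to the base, is at most the block length.\<close>
  also have "\<dots> \<le> (\<Sum>i<n. \<integral>\<^sup>+ x\<in>E. ennreal (\<phi> (real (k (n - 1) x))) \<partial>M)"
  proof (intro sum_mono nn_integral_mono)
    fix i x assume "i \<in> {..<n}"
    show "ennreal (\<phi> (real_of_int \<bar>int (k (Suc i mod n) x) - int (k i x)\<bar>)) * indicator E x
        \<le> ennreal (\<phi> (real (k (n - 1) x))) * indicator E x"
    proof (cases "x \<in> E")
      case True
      then have "k (Suc i mod n) x \<le> k (n - 1) x" "k i x \<le> k (n - 1) x"
        using k_le[of x "Suc i mod n"] k_le[of x i] \<open>i \<in> {..<n}\<close> n by auto
      then have "real_of_int \<bar>int (k (Suc i mod n) x) - int (k i x)\<bar> \<le> real (k (n - 1) x)"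
        by linarith
      then show ?thesis by (intro mult_right_mono ennreal_leI \<phi>_mono) auto
    qed simp
  qed
  also have "\<dots> = of_nat n * (\<integral>\<^sup>+ x\<in>E. ennreal (\<phi> (real (k (n - 1) x))) \<partial>M)"
    by simp
  also have "(\<integral>\<^sup>+ x\<in>E. ennreal (\<phi> (real (k (n - 1) x))) \<partial>M) \<le> ennreal (2 * (b 0 + 2))"
  proof -
    \<comment> \<open>Stage 0 starts from \<open>A\<close>, which need not be small; its measure is
      bounded by 1, and the factor \<open>b 0 + 1\<close> fits this stage into a common geometric
      bound.\<close>
    have bB: "ennreal (b m) * emeasure M (B m) \<le> ennreal ((b 0 + 1) * (1/2)^m)" for m
    proof (cases m)
      case 0
      have "ennreal (b 0) * emeasure M (B 0) \<le> ennreal (b 0) * 1"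
        by (intro mult_left_mono) (auto simp: emeasure_le_1)
      also have "\<dots> \<le> ennreal (b 0 + 1)" by (simp add: ennreal_leI)
      finally show ?thesis using 0 by simp
    next
      case (Suc m')
      have "ennreal (b m) * emeasure M (B m) \<le> ennreal (b m) * ennreal (\<epsilon> m)"
        unfolding Suc by (intro mult_left_mono B_le) auto
      also have "\<dots> = ennreal (b m * \<epsilon> m)" using b(1) \<epsilon>_pos[of m] by (simp add: ennreal_mult)
      also have "\<dots> \<le> ennreal ((b 0 + 1) * (1/2)^m)"
        using b\<epsilon>[of m] b(1)[of 0] by (intro ennreal_leI) (simp add: distrib_right add_increasing)
      finally show ?thesis .
    qed
    have "(\<integral>\<^sup>+ x\<in>E. ennreal (\<phi> (real (k (n - 1) x))) \<partial>M)
        \<le> (\<integral>\<^sup>+ x. (\<Sum>m. ennreal (\<phi> (real (k (n - 1) x))) * indicator (D m) x) \<partial>M)"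
    proof (intro nn_integral_mono)
      fix x
      show "ennreal (\<phi> (real (k (n - 1) x))) * indicator E x
          \<le> (\<Sum>m. ennreal (\<phi> (real (k (n - 1) x))) * indicator (D m) x)"
      proof (cases "x \<in> E")
        case True
        then obtain m where "x \<in> D m" by (auto simp: E_def)
        then show ?thesis
          using True sum_le_suminf[of "\<lambda>m. ennreal (\<phi> (real (k (n - 1) x))) * indicator (D m) x" "{m}"]
          by simp
      qed simp
    qed
    also have "\<dots> = (\<Sum>m. \<integral>\<^sup>+ x\<in>D m. ennreal (\<phi> (real (k (n - 1) x))) \<partial>M)"
      by (intro nn_integral_suminf) measurable
    also have "\<dots> \<le> (\<Sum>m. ennreal ((b 0 + 2) * (1/2)^m))"
    proof (intro suminf_le)
      fix m
      have "(\<integral>\<^sup>+ x\<in>D m. ennreal (\<phi> (real (k (n - 1) x))) \<partial>M)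
          = (\<integral>\<^sup>+ x\<in>D m. ennreal (\<phi> (real (visit_time (B m) (n - 1) x))) \<partial>M)"
        by (intro nn_integral_cong) (auto simp: indicator_def k)
      also have "\<dots> \<le> ennreal (b m) * emeasure M (B m) + ennreal ((1/2)^m)"
        using b by (intro nn_integral_block_length_le D) auto
      also have "\<dots> \<le> ennreal ((b 0 + 1) * (1/2)^m) + ennreal ((1/2)^m)"
        by (intro add_right_mono bB)
      also have "\<dots> = ennreal ((b 0 + 2) * (1/2)^m)"
        using b(1)[of 0] by (subst ennreal_plus[symmetric]) (auto simp: algebra_simps)
      finally show "(\<integral>\<^sup>+ x\<in>D m. ennreal (\<phi> (real (k (n - 1) x))) \<partial>M) \<le> ennreal ((b 0 + 2) * (1/2)^m)" .
    qed auto
    also have "\<dots> = ennreal (\<Sum>m. (b 0 + 2) * (1/2)^m)"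
      using b(1)[of 0] by (intro suminf_ennreal2) (auto intro!: summable_mult summable_geometric)
    also have "(\<Sum>m. (b 0 + 2) * (1/2)^m) = 2 * (b 0 + 2)"
      by (subst suminf_mult) (auto simp: suminf_geometric intro!: summable_geometric)
    finally show ?thesis .
  qed
  finally have cost: "(\<integral>\<^sup>+ y. ennreal (\<phi> (real_of_int \<bar>c y\<bar>)) \<partial>M) \<le> of_nat n * ennreal (2 * (b 0 + 2))"
    by (simp add: mult_left_mono)
  also have "\<dots> < \<infinity>" by (simp add: ennreal_mult_less_top ennreal_of_nat_eq_real_of_nat)
  finally have cost: "(\<integral>\<^sup>+ y. ennreal (\<phi> (real_of_int \<bar>c y\<bar>)) \<partial>M) < \<infinity>" .

  \<comment> \<open>This intersection consists of the points of \<open>A\<close> that no stage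
    covers.\<close>
  have "emeasure M (\<Inter>m. B m) = 0"
  proof -
    have "emeasure M (\<Inter>m. B m) \<le> ennreal ((1/2)^Suc m)" for m
    proof -
      have "emeasure M (\<Inter>m. B m) \<le> emeasure M (B (Suc m))" by (intro emeasure_mono) auto
      also have "\<dots> \<le> ennreal (\<epsilon> (Suc m))" by (rule B_le)
      also have "\<dots> \<le> ennreal ((1/2)^Suc m)" by (intro ennreal_leI \<epsilon>_le)
      finally show ?thesis .
    qed
    moreover have "(\<lambda>m. ennreal ((1/2)^Suc m)) \<longlonglongrightarrow> ennreal 0"
      by (intro tendsto_ennrealI LIMSEQ_Suc LIMSEQ_power_zero) auto
    ultimately have "emeasure M (\<Inter>m. B m) \<le> ennreal 0"
      by (intro LIMSEQ_le_const) auto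
    then show ?thesis by simp
  qed
  then have "AE y in M. y \<notin> (\<Inter>m. B m)"
    by (intro AE_not_in) (auto simp: null_sets_def)
  moreover have "y \<in> (\<Union>m. blocks n (B m) (D m)) \<longleftrightarrow> y \<in> A" if "y \<notin> (\<Inter>m. B m)" for y
  proof
    assume "y \<in> (\<Union>m. blocks n (B m) (D m))"
    then obtain m where "y \<in> blocks n (B m) (D m)" by auto
    then show "y \<in> A" using D[of m] B_antimono[of 0 m] by (auto simp: block_base_def B_0)
  next
    assume "y \<in> A"
    show "y \<in> (\<Union>m. blocks n (B m) (D m))"
    proof (rule ccontr)
      assume "y \<notin> (\<Union>m. blocks n (B m) (D m))"
      then have "y \<in> B m" for m by (induction m) (auto simp: B_0 B_Suc \<open>y \<in> A\<close>)
      then show False using that by auto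
    qed
  qed
  ultimately have "AE y in M. \<sigma> (c y) y \<noteq> y \<longleftrightarrow> y \<in> A"
    unfolding support union by (auto elim: eventually_mono)
  then show ?thesis using c cycle cost by blast
qed

end

text \<open>The separating cover yields the marker set. Kac with constant \<open>K = N\<close> turns
  separation into smallness, and translating the two-sided hitting property along the orbit gives
  visits in both directions.\<close>

lemma exists_small_marker:
  fixes M :: "('a::polish_space) measure"
  assumes "pmp_int_action M \<sigma>" and "sets M = sets borel"
  shows "\<exists>C\<in>sets M. of_nat (N + 1) * emeasure M C \<le> 1 \<and>
    (\<forall>x\<in>pmp_int_action.free_part \<sigma>. (\<exists>j\<ge>1. \<sigma> (int j) x \<in> C) \<and> (\<exists>j. \<sigma> (- int j) x \<in> C))"
proof -
  interpret pmp_int_action M \<sigma> by fact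
  have "\<sigma> j \<in> borel_measurable borel" for j
    using act_measurable[of j] measurable_cong_sets[OF assms(2) assms(2)] by simp
  from exists_separating_cover[where \<sigma>=\<sigma>, OF this, of "int N"]
  obtain E :: "nat \<Rightarrow> 'a set" where E0: "\<forall>m. E m \<in> sets borel"
      "\<forall>m x j. x \<in> E m \<longrightarrow> 1 \<le> j \<longrightarrow> j \<le> int N \<longrightarrow> \<sigma> j x \<notin> E m"
      "{x. \<forall>j. j \<noteq> 0 \<longrightarrow> \<sigma> j x \<noteq> x} \<subseteq> (\<Union>m. E m)"
    by (elim exE conjE)
  then have E: "\<And>m. E m \<in> sets M"
      "\<And>m x j. x \<in> E m \<Longrightarrow> 1 \<le> j \<Longrightarrow> j \<le> int N \<Longrightarrow> \<sigma> j x \<notin> E m"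
      "free_part \<subseteq> (\<Union>m. E m)"
    by (simp_all add: assms(2) free_part_def)
  have "\<exists>C\<in>sets M. (\<forall>x\<in>C. \<forall>j. 1 \<le> j \<longrightarrow> j \<le> int N \<longrightarrow> \<sigma> j x \<notin> C) \<and>
      (\<forall>x\<in>free_part. \<exists>j\<in>{- int N..int N}. \<sigma> j x \<in> C)"
    by (intro exists_marker_of_cover[of E] E) auto
  then obtain C where C [measurable]: "C \<in> sets M"
    and sep: "\<And>x j. x \<in> C \<Longrightarrow> 1 \<le> j \<Longrightarrow> j \<le> int N \<Longrightarrow> \<sigma> j x \<notin> C"
    and hit: "\<And>x. x \<in> free_part \<Longrightarrow> \<exists>j\<in>{- int N..int N}. \<sigma> j x \<in> C"
    by auto
  have "(\<integral>\<^sup>+ x\<in>C. of_nat (N + 1) \<partial>M) \<le> 1"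
    by (intro kac_inequality[where K="\<lambda>_. N"] sep) auto
  then have "of_nat (N + 1) * emeasure M C \<le> 1"
    by (subst (asm) nn_integral_cmult_indicator) auto
  moreover have "\<exists>j\<ge>1. \<sigma> (int j) x \<in> C" if x: "x \<in> free_part" for x
  proof -
    obtain j where j: "j \<in> {- int N..int N}" "\<sigma> j (\<sigma> (int N + 1) x) \<in> C"
      using hit[of "\<sigma> (int N + 1) x"] x by auto
    then show ?thesis
      by (intro exI[of _ "nat (j + (int N + 1))"]) (auto simp: act_add)
  qed
  moreover have "\<exists>j. \<sigma> (- int j) x \<in> C" if x: "x \<in> free_part" for x
  proof -
    obtain j where j: "j \<in> {- int N..int N}" "\<sigma> j (\<sigma> (- int N) x) \<in> C"
      using hit[of "\<sigma> (- int N) x"] x by auto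
    then show ?thesis
      by (intro exI[of _ "nat (int N - j)"]) (auto simp flip: act_add)
  qed
  ultimately show ?thesis using C by blast
qed

text \<open>With \<open>N > n / \<epsilon>\<close> the remainder has measure at most
  \<open>n / (N + 1) < \<epsilon>\<close>. This supplies the hypothesis \<open>step\<close> of
  \<open>exists_cycle_with_support\<close>.\<close>

lemma exists_block_base_small_remainder:
  fixes M :: "('a::polish_space) measure"
  assumes "pmp_int_action M \<sigma>" and "sets M = sets borel" and "0 < n"
    and B: "B \<in> sets M" "B \<subseteq> pmp_int_action.free_part \<sigma>" and "0 < \<epsilon>"
  shows "\<exists>D. pmp_int_action.block_base M \<sigma> n B D \<and>
    emeasure M (B - pmp_int_action.blocks \<sigma> n B D) \<le> ennreal \<epsilon>"
proof -
  interpret pmp_int_action M \<sigma> by fact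
  obtain N :: nat where N: "real n / \<epsilon> < real N" using reals_Archimedean2 by blast
  obtain C where C: "C \<in> sets M" "of_nat (N + 1) * emeasure M C \<le> 1"
      "\<And>x. x \<in> free_part \<Longrightarrow> \<exists>j\<ge>1. \<sigma> (int j) x \<in> C" "\<And>x. x \<in> free_part \<Longrightarrow> \<exists>j. \<sigma> (- int j) x \<in> C"
    using exists_small_marker[OF assms(1,2), of N] by blast
  have eC: "emeasure M C = ennreal (measure M C)" by (rule emeasure_eq_measure)
  have "ennreal (real (N + 1) * measure M C) \<le> ennreal 1"
    using C(2) unfolding eC ennreal_of_nat_eq_real_of_nat by (simp add: ennreal_mult)
  then have mC: "real (N + 1) * measure M C \<le> 1" by (subst (asm) ennreal_le_iff) auto
  have "real n \<le> \<epsilon> * real (N + 1)" using N \<open>0 < \<epsilon>\<close> by (simp add: field_simps)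
  then have "real n * measure M C \<le> \<epsilon> * real (N + 1) * measure M C" by (rule mult_right_mono) simp
  also have "\<dots> \<le> \<epsilon>" using mult_left_mono[OF mC, of \<epsilon>] \<open>0 < \<epsilon>\<close> by (simp add: mult.assoc)
  finally have "of_nat n * emeasure M C \<le> ennreal \<epsilon>"
    unfolding eC ennreal_of_nat_eq_real_of_nat by (subst ennreal_mult[symmetric]) (auto intro: ennreal_leI)
  then show ?thesis
    using exists_block_base[OF B(1) C(1) \<open>0 < n\<close> B(2) C(3,4)] by (blast intro: order_trans)
qed

section \<open>The integer action generated by one transformation\<close>

lemma pmp_int_action_ipow:
  assumes "prob_space M" "space M = UNIV" "aut M T"
  shows "pmp_int_action M (ipow M T)"
proof -
  define S where "S = the_inv_into UNIV T"
  have T [measurable]: "T \<in> M \<rightarrow>\<^sub>M M" and S [measurable]: "S \<in> M \<rightarrow>\<^sub>M M"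
    and bij: "bij T" and distr_T: "distr M M T = M"
    using assms by (auto simp: aut_def S_def)
  have ST [simp]: "S (T x) = x" "T (S x) = x" for x
    using bij by (auto simp: S_def bij_def the_inv_into_f_f f_the_inv_into_f)
  have ipow: "ipow M T k = (if 0 \<le> k then T ^^ nat k else S ^^ nat (- k))" for k
    by (simp add: ipow_def S_def assms(2))
  have suc: "ipow M T (k + 1) x = T (ipow M T k x)" for k x
  proof (cases "0 \<le> k")
    case True
    then show ?thesis by (simp add: ipow nat_add_distrib)
  next
    case False
    then have "nat (- k) = Suc (nat (- (k + 1)))" by simp
    then show ?thesis using False by (auto simp: ipow)
  qed
  have pre: "ipow M T (k - 1) x = S (ipow M T k x)" for k x
    using suc[of "k - 1" x] by simp
  have "ipow M T (a + b) x = ipow M T a (ipow M T b x)" for a b x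
  proof (induction a rule: int_induct[where k=0])
    case (step1 i)
    then show ?case using suc[of "i + b"] suc[of i] by (simp add: algebra_simps)
  next
    case (step2 i)
    then show ?case using pre[of "i + b"] pre[of i] by (simp add: algebra_simps)
  qed (simp add: ipow)
  moreover have meas: "ipow M T a \<in> M \<rightarrow>\<^sub>M M" for a
    unfolding ipow by (auto intro: measurable_compose_n)
  moreover have "distr M M (ipow M T a) = M" for a
  proof (induction a rule: int_induct[where k=0])
    case base
    then show ?case by (simp add: ipow distr_id id_def)
  next
    case (step1 i)
    have "ipow M T (i + 1) = T \<circ> ipow M T i" using suc by auto
    then show ?case using step1 distr_distr[OF T meas[of i]] distr_T by metis
  next
    case (step2 i)
    \<comment> \<open>The inverse preserves the measure: write \<open>M\<close> as its own image
      under \<open>T\<close> and push it forward by \<open>S\<close>.\<close>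
    have "distr M M S = distr (distr M M T) M S" by (simp add: distr_T)
    also have "\<dots> = M" by (simp add: distr_distr comp_def)
    finally have "distr M M S = M" .
    moreover have "ipow M T (i - 1) = S \<circ> ipow M T i" using pre by auto
    ultimately show ?case using step2 distr_distr[OF S meas[of i]] by metis
  qed
  ultimately show ?thesis
    using assms by (auto simp: pmp_int_action_def pmp_int_action_axioms_def ipow)
qed

theorem mainTheorem10:
  fixes M :: "('a::polish_space) measure" and \<phi> :: "real \<Rightarrow> real" and T :: "'a \<Rightarrow> 'a"
  assumes "standard_atomless_prob M"
    and "metric_compatible \<phi>" and "sublinear \<phi>"
    and "aut M T" and "aperiodic M T"
    and "A \<in> sets M" and "(n::nat) \<ge> 2"
  shows "\<exists>P. is_n_cycle M n P \<and> P \<in> phi_full_group \<phi> M T \<and>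
             (AE x in M. P x \<noteq> x \<longleftrightarrow> x \<in> A)"
proof -
  have M: "prob_space M" "sets M = sets borel"
    using assms(1) by (auto simp: standard_atomless_prob_def)
  have "space M = UNIV" using sets_eq_imp_space_eq[OF M(2)] by simp
  then have act: "pmp_int_action M (ipow M T)" using M(1) assms(4) by (intro pmp_int_action_ipow)
  interpret pmp_int_action M "ipow M T" by (rule act)
  \<comment> \<open>The free part is a countable intersection of complements of equality sets, whose
    measurability needs maps with target \<open>borel\<close>.\<close>
  have [measurable]: "ipow M T j \<in> borel_measurable M" for j
    using act_measurable[of j] measurable_cong_sets[OF refl M(2)] by blast
  have [measurable]: "(\<lambda>x. x) \<in> borel_measurable M"
    using measurable_ident_sets[OF M(2)] .
  have "{x \<in> space M. \<forall>j\<in>UNIV - {0}. \<not> ipow M T j x = x} \<in> sets M"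
    by measurable
  moreover have "{x \<in> space M. \<forall>j\<in>UNIV - {0}. \<not> ipow M T j x = x} = free_part"
    by (auto simp: free_part_def)
  ultimately have free_sets: "free_part \<in> sets M" by simp
  have free: "AE x in M. x \<in> free_part"
    using assms(5) unfolding aperiodic_def
  proof (rule AE_mp, intro AE_I2 impI)
    fix x assume x: "\<forall>n::nat. 0 < n \<longrightarrow> (T ^^ n) x \<noteq> x"
    have pos: "ipow M T j x \<noteq> x" if "0 < j" for j
      using x[rule_format, of "nat j"] that by (simp add: ipow_def)
    \<comment> \<open>Aperiodicity concerns positive powers; a point fixed by a negative power is
      also fixed by the opposite positive one.\<close>
    have "ipow M T j x \<noteq> x" if "j \<noteq> 0" for j
    proof (cases "0 < j")
      case False
      then have "ipow M T (- j) x \<noteq> x" using pos[of "- j"] that by simp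
      then show ?thesis using act_inverse(1)[of j x] by metis
    qed (rule pos)
    then show "x \<in> free_part" by (simp add: free_part_def)
  qed
  \<comment> \<open>The construction works inside the free part; intersecting with it changes
    \<open>A\<close> only by a null set.\<close>
  have "A \<inter> free_part \<in> sets M" using assms(6) free_sets by auto
  then have "\<exists>c. c \<in> M \<rightarrow>\<^sub>M count_space UNIV \<and> is_n_cycle M n (\<lambda>y. ipow M T (c y) y) \<and>
      (\<integral>\<^sup>+ y. ennreal (\<phi> (real_of_int \<bar>c y\<bar>)) \<partial>M) < \<infinity> \<and>
      (AE y in M. ipow M T (c y) y \<noteq> y \<longleftrightarrow> y \<in> A \<inter> free_part)"
    using assms(7)
    by (intro exists_cycle_with_support assms exists_block_base_small_remainder[OF act M(2)]) auto
  then obtain c where c: "c \<in> M \<rightarrow>\<^sub>M count_space UNIV" "is_n_cycle M n (\<lambda>y. ipow M T (c y) y)"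
      "(\<integral>\<^sup>+ y. ennreal (\<phi> (real_of_int \<bar>c y\<bar>)) \<partial>M) < \<infinity>"
      "AE y in M. ipow M T (c y) y \<noteq> y \<longleftrightarrow> y \<in> A \<inter> free_part"
    by (elim exE conjE)
  have "AE y in M. ipow M T (c y) y \<noteq> y \<longleftrightarrow> y \<in> A"
    using c(4) free by eventually_elim auto
  then show ?thesis
    using c(1-3) by (intro exI[of _ "\<lambda>y. ipow M T (c y) y"]) (auto simp: is_n_cycle_def phi_full_group_def)
qed

end
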